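(* Let $A\subset\mathbb R^2$ be the compact estimation set, let $L>0$, $\boldsymbol\alpha=(\alpha_1,\alpha_2)$ with $\alpha_1,\alpha_2>0$, and let $\mathcal B$ be the set of all transition densities $\pi$ on $\mathbb R$ of positive recurrent Markov chains such that $\|\pi\|_{B_{2,\infty}^{\boldsymbol\alpha}(A)}\le L$. Then there exists a positive constant $C$ such that, if $n$ is large enough, $$\inf_{\hat\pi_n}\ \sup_{\pi\in\mathcal B}\ \mathbb E_\pi\|\hat\pi_n-\pi\|_A^2\ \ge\ C\,n^{-\frac{2\bar\alpha}{2\bar\alpha+2}},$$ where the infimum is taken over all estimators $\hat\pi_n$ of $\pi$ based on the observations $X_1,\dots,X_{n+1}$, and $\bar\alpha$ is the harmonic mean of $\alpha_1$ and $\alpha_2$, i.e. $2/\bar\alpha=1/\alpha_1+1/\alpha_2$.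
   Context: $A=A_1\times A_2$ is a compact subset of $\mathbb R^2$ (with $A_1,A_2$ nondegenerate intervals). $\|g\|_A=\big(\int_A|g|^2\big)^{1/2}$ is the norm of $L^2(A)$. $\mathbb E_\pi$ denotes the expectation corresponding to the distribution of the observations when the true transition density of the Markov chain is $\pi$ and the initial distribution is the stationary distribution. A transition density $\pi$ means that $P(X_{i+1}\in dy\mid X_i=x)=\pi(x,y)\,dy$. Anisotropic Besov space: let $e_1,e_2$ be the canonical basis of $\mathbb R^2$, $A_{h,i}^r=\{x\in\mathbb R^2:\ x,x+he_i,\dots,x+rhe_i\in A\}$, $\Delta_{h,i}^rg(x)=\sum_{k=0}^r(-1)^{r-k}\binom rk g(x+khe_i)$ for $x\in A_{h,i}^r$, and $\omega_{r_i,i}(g,t)=\sup_{|h|\le t}\big(\int_{A_{h,i}^{r_i}}|\Delta_{h,i}^{r_i}g(x)|^2dx\big)^{1/2}$. For fixed integers $r_i$ larger than $\alpha_i$, $g\in L^2(A)$ is in $B_{2,\infty}^{\boldsymbol\alpha}(A)$ if $\sup_{t>0}\sum_{i=1}^2t^{-\alpha_i}\omega_{r_i,i}(g,t)<\infty$, and $$\|g\|_{B_{2,\infty}^{\boldsymbol\alpha}(A)}=\|g\|_A+\sup_{t>0}\sum_{i=1}^2t^{-\alpha_i}\omega_{r_i,i}(g,t);$$ for $\pi$ this is the norm of its restriction to $A$. *)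

theory Defs
  imports "HOL-Probability.Probability"
begin

section \<open>Anisotropic Besov spaces on subsets of the plane\<close>

definition square_integrable_on :: "(real \<times> real) set \<Rightarrow> (real \<times> real \<Rightarrow> real) \<Rightarrow> bool" where
  "square_integrable_on A g \<longleftrightarrow>
     set_borel_measurable lborel A g \<and> set_integrable lborel A (\<lambda>z. (g z)\<^sup>2)"

definition L2_norm_on :: "(real \<times> real) set \<Rightarrow> (real \<times> real \<Rightarrow> real) \<Rightarrow> real" where
  "L2_norm_on A g = sqrt (LINT z:A|lborel. (g z)\<^sup>2)"

definition diff_domain :: "(real \<times> real) set \<Rightarrow> real \<times> real \<Rightarrow> nat \<Rightarrow> real \<Rightarrow> (real \<times> real) set" where
  "diff_domain A e r h = {z. \<forall>k\<le>r. z + (real k * h) *\<^sub>R e \<in> A}"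

definition iterated_diff ::
    "real \<times> real \<Rightarrow> nat \<Rightarrow> real \<Rightarrow> (real \<times> real \<Rightarrow> real) \<Rightarrow> real \<times> real \<Rightarrow> real" where
  "iterated_diff e r h g z =
     (\<Sum>k\<le>r. (- 1) ^ (r - k) * real (r choose k) * g (z + (real k * h) *\<^sub>R e))"

text \<open>
  For \<open>g\<close> square integrable on \<open>A\<close> the supremum below is over a bounded set, since the
  \<open>r\<close>-th difference has norm at most \<open>2 ^ r\<close> times that of \<open>g\<close>.
\<close>

definition modulus ::
    "(real \<times> real) set \<Rightarrow> real \<times> real \<Rightarrow> nat \<Rightarrow> (real \<times> real \<Rightarrow> real) \<Rightarrow> real \<Rightarrow> real" where
  "modulus A e r g t =
     (SUP h\<in>{h. \<bar>h\<bar> \<le> t}. L2_norm_on (diff_domain A e r h) (iterated_diff e r h g))"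

definition besov_modulus ::
    "real \<Rightarrow> real \<Rightarrow> nat \<Rightarrow> nat \<Rightarrow> (real \<times> real) set \<Rightarrow> (real \<times> real \<Rightarrow> real) \<Rightarrow> real \<Rightarrow> real" where
  "besov_modulus \<alpha>1 \<alpha>2 r1 r2 A g t =
     t powr (- \<alpha>1) * modulus A (1, 0) r1 g t + t powr (- \<alpha>2) * modulus A (0, 1) r2 g t"

definition besov_space ::
    "real \<Rightarrow> real \<Rightarrow> nat \<Rightarrow> nat \<Rightarrow> (real \<times> real) set \<Rightarrow> (real \<times> real \<Rightarrow> real) set" where
  "besov_space \<alpha>1 \<alpha>2 r1 r2 A =
     {g. square_integrable_on A g \<and> bdd_above (besov_modulus \<alpha>1 \<alpha>2 r1 r2 A g ` {0<..})}"

text \<open>Only meaningful on \<^const>\<open>besov_space\<close>: elsewhere the real-valued supremum is unspecified.\<close>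

definition besov_norm ::
    "real \<Rightarrow> real \<Rightarrow> nat \<Rightarrow> nat \<Rightarrow> (real \<times> real) set \<Rightarrow> (real \<times> real \<Rightarrow> real) \<Rightarrow> real" where
  "besov_norm \<alpha>1 \<alpha>2 r1 r2 A g =
     L2_norm_on A g + (SUP t\<in>{0<..}. besov_modulus \<alpha>1 \<alpha>2 r1 r2 A g t)"


section \<open>Markov chains on the real line given by a transition density\<close>

definition transition_density :: "(real \<times> real \<Rightarrow> real) \<Rightarrow> bool" where
  "transition_density \<pi> \<longleftrightarrow>
     \<pi> \<in> borel_measurable borel \<and> (\<forall>z. 0 \<le> \<pi> z) \<and>
     (\<forall>x. (\<integral>\<^sup>+y. ennreal (\<pi> (x, y)) \<partial>lborel) = 1)"

definition trans_kernel :: "(real \<times> real \<Rightarrow> real) \<Rightarrow> real \<Rightarrow> real measure" where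
  "trans_kernel \<pi> x = density lborel (\<lambda>y. ennreal (\<pi> (x, y)))"

definition nstep_kernel :: "(real \<times> real \<Rightarrow> real) \<Rightarrow> nat \<Rightarrow> real \<Rightarrow> real measure" where
  "nstep_kernel \<pi> n x = ((\<lambda>\<nu>. \<nu> \<bind> trans_kernel \<pi>) ^^ n) (return borel x)"

definition invariant_distribution :: "(real \<times> real \<Rightarrow> real) \<Rightarrow> real measure \<Rightarrow> bool" where
  "invariant_distribution \<pi> \<mu> \<longleftrightarrow>
     sets \<mu> = sets borel \<and> prob_space \<mu> \<and> \<mu> \<bind> trans_kernel \<pi> = \<mu>"

text \<open>
  Irreducibility and recurrence on a general state space follow Meyn and Tweedie, \<^emph>\<open>Markov
  Chains and Stochastic Stability\<close>: a chain is recurrent if it is irreducible with maximal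
  irreducibility measure \<open>\<psi>\<close> and, from every starting point, the expected number of visits to
  every set of positive \<open>\<psi>\<close>-measure is infinite; it is positive if it moreover has an invariant
  probability measure. Maximal irreducibility measures all have the same null sets, so the
  choice of \<open>\<psi>\<close> does not matter.
\<close>

definition irreducibility_measure :: "(real \<times> real \<Rightarrow> real) \<Rightarrow> real measure \<Rightarrow> bool" where
  "irreducibility_measure \<pi> \<phi> \<longleftrightarrow>
     sets \<phi> = sets borel \<and> sigma_finite_measure \<phi> \<and> emeasure \<phi> UNIV > 0 \<and>
     (\<forall>B\<in>sets borel. emeasure \<phi> B > 0 \<longrightarrow>
        (\<forall>x. \<exists>n\<ge>1. emeasure (nstep_kernel \<pi> n x) B > 0))"

definition maximal_irreducibility_measure :: "(real \<times> real \<Rightarrow> real) \<Rightarrow> real measure \<Rightarrow> bool" where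
  "maximal_irreducibility_measure \<pi> \<psi> \<longleftrightarrow>
     irreducibility_measure \<pi> \<psi> \<and>
     (\<forall>\<phi>. irreducibility_measure \<pi> \<phi> \<longrightarrow> absolutely_continuous \<psi> \<phi>)"

definition recurrent :: "(real \<times> real \<Rightarrow> real) \<Rightarrow> bool" where
  "recurrent \<pi> \<longleftrightarrow>
     (\<exists>\<psi>. maximal_irreducibility_measure \<pi> \<psi> \<and>
       (\<forall>B\<in>sets borel. emeasure \<psi> B > 0 \<longrightarrow>
          (\<forall>x. (\<Sum>n. emeasure (nstep_kernel \<pi> (Suc n) x) B) = \<infinity>)))"

definition positive_recurrent :: "(real \<times> real \<Rightarrow> real) \<Rightarrow> bool" where
  "positive_recurrent \<pi> \<longleftrightarrow> recurrent \<pi> \<and> (\<exists>\<mu>. invariant_distribution \<pi> \<mu>)"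

text \<open>A positive recurrent chain has exactly one invariant distribution.\<close>

definition stationary_distribution :: "(real \<times> real \<Rightarrow> real) \<Rightarrow> real measure" where
  "stationary_distribution \<pi> = (THE \<mu>. invariant_distribution \<pi> \<mu>)"

text \<open>
  The path \<open>\<omega>\<close> is indexed from \<open>0\<close>, so that \<open>\<omega> i\<close> is the observation \<open>X\<^bsub>i+1\<^esub>\<close>.
  \<open>stationary_step \<pi> i \<omega>\<close> is the conditional law of \<open>\<omega> i\<close> given \<open>\<omega> 0, \<dots>, \<omega> (i - 1)\<close>, and
  \<open>observation_law \<pi> n\<close> is the joint law of \<open>X\<^sub>1, \<dots>, X\<^bsub>n+1\<^esub>\<close> on \<open>{0..<n + 1} \<rightarrow>\<^sub>E \<real>\<close>.
\<close>

definition stationary_step ::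
    "(real \<times> real \<Rightarrow> real) \<Rightarrow> nat \<Rightarrow> (nat \<Rightarrow> real) \<Rightarrow> real measure" where
  "stationary_step \<pi> i \<omega> =
     (if i = 0 then stationary_distribution \<pi> else trans_kernel \<pi> (\<omega> (i - 1)))"

definition observation_law :: "(real \<times> real \<Rightarrow> real) \<Rightarrow> nat \<Rightarrow> (nat \<Rightarrow> real) measure" where
  "observation_law \<pi> n =
     Ionescu_Tulcea.C (stationary_step \<pi>) (\<lambda>_. borel) 0 (n + 1) (\<lambda>_. undefined)"

lemma measurable_trans_kernel:
  assumes "transition_density \<pi>"
  shows "trans_kernel \<pi> \<in> borel \<rightarrow>\<^sub>M prob_algebra borel"
proof (rule measurable_prob_algebraI)
  have [measurable]: "\<pi> \<in> borel_measurable (borel \<Otimes>\<^sub>M borel)"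
    using assms by (simp add: transition_density_def borel_prod)
  show P: "prob_space (trans_kernel \<pi> x)" for x
  proof
    show "emeasure (trans_kernel \<pi> x) (space (trans_kernel \<pi> x)) = 1"
      using assms by (simp add: trans_kernel_def transition_density_def emeasure_density)
  qed
  show "trans_kernel \<pi> \<in> borel \<rightarrow>\<^sub>M subprob_algebra borel"
  proof (rule measurable_subprob_algebra)
    show "subprob_space (trans_kernel \<pi> x)" for x
      by (rule prob_space_imp_subprob_space[OF P])
    show "sets (trans_kernel \<pi> x) = sets borel" for x
      by (simp add: trans_kernel_def)
    show "(\<lambda>x. emeasure (trans_kernel \<pi> x) B) \<in> borel_measurable borel"
      if [measurable]: "B \<in> sets borel" for B
    proof -
      have "(\<lambda>x. emeasure (trans_kernel \<pi> x) B) =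
          (\<lambda>x. \<integral>\<^sup>+y. ennreal (\<pi> (x, y)) * indicator B y \<partial>lborel)"
        by (simp add: trans_kernel_def emeasure_density)
      then show ?thesis by simp
    qed
  qed
qed

lemma Ionescu_Tulcea_stationary_step:
  assumes "transition_density \<pi>" "invariant_distribution \<pi> (stationary_distribution \<pi>)"
  shows "Ionescu_Tulcea (stationary_step \<pi>) (\<lambda>_. borel)"
proof (rule Ionescu_Tulcea.intro)
  have K: "trans_kernel \<pi> \<in> borel \<rightarrow>\<^sub>M prob_algebra borel"
    by (rule measurable_trans_kernel) fact
  have S: "stationary_distribution \<pi> \<in> space (prob_algebra borel)"
    using assms(2) by (simp add: space_prob_algebra invariant_distribution_def)
  have "stationary_step \<pi> i \<in> PiM {0..<i} (\<lambda>_. borel) \<rightarrow>\<^sub>M prob_algebra borel" for i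
  proof (cases "i = 0")
    case True
    then show ?thesis
      using S by (simp add: stationary_step_def[abs_def])
  next
    case False
    then have "(\<lambda>\<omega>. trans_kernel \<pi> (\<omega> (i - 1))) \<in> PiM {0..<i} (\<lambda>_. borel) \<rightarrow>\<^sub>M prob_algebra borel"
      by (intro measurable_compose[OF _ K] measurable_component_singleton) auto
    with False show ?thesis by (simp add: stationary_step_def[abs_def])
  qed
  note M = this
  show "stationary_step \<pi> i \<in> PiM {0..<i} (\<lambda>_. borel) \<rightarrow>\<^sub>M subprob_algebra borel" for i
    by (rule measurable_prob_algebraD[OF M])
  show "prob_space (stationary_step \<pi> i \<omega>)" if "\<omega> \<in> space (PiM {0..<i} (\<lambda>_. borel :: real measure))"
    for i \<omega>
    using measurable_space[OF M that] by (simp add: space_prob_algebra)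
qed


section \<open>Estimation of the transition density\<close>

text \<open>An estimator maps the observed path and a point of the plane to an estimate of \<open>\<pi>\<close> there.\<close>

definition estimators :: "nat \<Rightarrow> ((nat \<Rightarrow> real) \<Rightarrow> real \<times> real \<Rightarrow> real) set" where
  "estimators n =
     {T. (\<lambda>(\<omega>, z). T \<omega> z) \<in> borel_measurable (PiM {0..<n + 1} (\<lambda>_. borel) \<Otimes>\<^sub>M borel)}"

text \<open>The loss is a nonnegative integral, hence \<open>\<infinity>\<close> if \<open>T \<omega> - \<pi>\<close> is not square integrable on \<open>A\<close>.\<close>

definition quadratic_risk ::
    "(real \<times> real) set \<Rightarrow> nat \<Rightarrow> ((nat \<Rightarrow> real) \<Rightarrow> real \<times> real \<Rightarrow> real) \<Rightarrow>
      (real \<times> real \<Rightarrow> real) \<Rightarrow> ennreal" where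
  "quadratic_risk A n T \<pi> =
     (\<integral>\<^sup>+\<omega>. (\<integral>\<^sup>+z\<in>A. ennreal ((T \<omega> z - \<pi> z)\<^sup>2) \<partial>lborel) \<partial>observation_law \<pi> n)"

definition besov_transition_class ::
    "real \<Rightarrow> real \<Rightarrow> nat \<Rightarrow> nat \<Rightarrow> (real \<times> real) set \<Rightarrow> real \<Rightarrow> (real \<times> real \<Rightarrow> real) set" where
  "besov_transition_class \<alpha>1 \<alpha>2 r1 r2 A L =
     {\<pi>. transition_density \<pi> \<and> positive_recurrent \<pi> \<and>
         \<pi> \<in> besov_space \<alpha>1 \<alpha>2 r1 r2 A \<and> besov_norm \<alpha>1 \<alpha>2 r1 r2 A \<pi> \<le> L}"

definition harmonic_mean :: "real \<Rightarrow> real \<Rightarrow> real" where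
  "harmonic_mean a b = 2 / (1 / a + 1 / b)"

end

theory Submission
  imports Defs
begin

text \<open>
  The bound is proved by Assouad's method: the risk is averaged over a family of transition densities
  indexed by the vertices of a hypercube. Neighbouring vertices are hard to tell apart from the
  observations, although each coordinate contributes its share to the distance in \<open>L\<^sup>2(A)\<close>.

  The family consists of perturbations of a chain of independent uniform variables. Let \<open>f\<close> be
  the uniform density on a long interval around both sides of \<open>A\<close>, of height \<open>f0\<close>. It is constant on
  \<open>A\<close>, so all its differences vanish there, and a small \<open>f0\<close> makes its norm small. Cut \<open>A\<close> into
  \<open>N1 \<cdot> N2\<close> congruent cells of widths \<open>h1\<close> and \<open>h2\<close>, put on each cell \<open>c\<close> a product \<open>\<psi>\<^sub>c\<close> of two smooth
  bumps of mean zero, and for each set \<open>S\<close> of cells let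
  \<open>\<pi>\<^sub>S(x, y) = f(y) + amp \<cdot> (\<Sum>c\<in>S. \<psi>\<^sub>c(x, y))\<close>. Mean zero in \<open>y\<close> keeps \<open>\<pi>\<^sub>S\<close> a transition density;
  mean zero in \<open>x\<close>, where \<open>f\<close> is constant, keeps \<open>f\<close> stationary. As the perturbation is at
  most \<open>f / 2\<close>, the chain satisfies a Doeblin condition, whence it is positive recurrent and \<open>f\<close> is
  its only invariant distribution (\<open>invariant_unique\<close>, \<open>positive_recurrent_\<pi>\<close>). The Besov norm of
  \<open>\<pi>\<^sub>S\<close> stays bounded as long as \<open>amp \<cdot> h1\<^bsup>-\<alpha>1\<^esup>\<close> and \<open>amp \<cdot> h2\<^bsup>-\<alpha>2\<^esup>\<close> do (\<open>dens_in_class\<close>).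

  Two members that differ in one cell have the same law of the first observation, so the likelihood
  ratio of the paths is a product over the transitions. Its second moment
  is controlled step by step (\<open>path_lr_second_moment\<close>). A ratio \<open>\<rho>\<close> of transition densities has
  conditional second moment \<open>1 + O(amp\<^sup>2 h2)\<close> when the chain sits in the column of the cell, and \<open>1\<close>
  elsewhere; the column is visited with probability \<open>O(h1)\<close>, whatever the previous state. A weight
  that is slightly larger than one on the column turns this into a growth factor
  \<open>1 + O(amp\<^sup>2 h1 h2)\<close> for each step (\<open>lr_step\<close>). Hence the second moment over \<open>n\<close> steps is bounded if
  \<open>n amp\<^sup>2 h1 h2\<close> is, the two laws overlap by a fixed amount (\<open>path_lr_overlap\<close>), and
  no estimator has small risk on the cell under both of them (\<open>two_point_risk\<close>). Averaging over all
  \<open>S\<close> (\<open>hypercube_average\<close>) gives a risk of the order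
  \<open>N1 N2 \<cdot> amp\<^sup>2 h1 h2\<close>, that is, of the order \<open>amp\<^sup>2\<close>.

  The choice \<open>h1 \<approx> amp\<^bsup>1/\<alpha>1\<^esup>\<close>, \<open>h2 \<approx> amp\<^bsup>1/\<alpha>2\<^esup>\<close> and \<open>n amp\<^sup>2 h1 h2 \<approx> 1\<close> leads to
  \<open>amp\<^bsup>2 + 1/\<alpha>1 + 1/\<alpha>2\<^esup> \<approx> 1 / n\<close>, and \<open>amp\<^sup>2\<close> is then the rate of the theorem.
\<close>

section \<open>Finite differences\<close>

definition fdiff :: "nat \<Rightarrow> real \<Rightarrow> (real \<Rightarrow> real) \<Rightarrow> real \<Rightarrow> real" where
  "fdiff r h g x = (\<Sum>k\<le>r. (- 1) ^ (r - k) * real (r choose k) * g (x + real k * h))"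

text \<open>
  By Pascal's rule the binomial sum is an iterated difference; inductions on the order use this form.
\<close>

lemma fdiff_Suc: "fdiff (Suc r) h g x = fdiff r h g (x + h) - fdiff r h g x"
proof -
  define a where "a k = (- 1) ^ (r - k) * g (x + real (Suc k) * h)" for k
  define b where "b k = (- 1) ^ (Suc r - k) * g (x + real k * h)" for k
  have sh: "fdiff r h g (x + h) = (\<Sum>k\<le>r. real (r choose k) * a k)"
    unfolding fdiff_def a_def by (intro sum.cong) (auto simp: algebra_simps)
  have "(\<Sum>k\<le>Suc r. real (r choose k) * b k) = (\<Sum>k\<le>r. real (r choose k) * b k)"
    by simp
  also have "\<dots> = - fdiff r h g x"
    unfolding fdiff_def b_def sum_negf[symmetric]
    by (intro sum.cong) (auto simp: algebra_simps Suc_diff_le)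
  finally have id: "(\<Sum>k\<le>Suc r. real (r choose k) * b k) = - fdiff r h g x" .
  have "fdiff (Suc r) h g x = (\<Sum>k\<le>Suc r. real (Suc r choose k) * b k)"
    unfolding fdiff_def b_def by (intro sum.cong) (auto simp: algebra_simps)
  also have "\<dots> = b 0 + (\<Sum>k\<le>r. real (Suc r choose Suc k) * b (Suc k))"
    by (subst sum.atMost_Suc_shift) simp
  also have "\<dots> = (b 0 + (\<Sum>k\<le>r. real (r choose Suc k) * b (Suc k)))
      + (\<Sum>k\<le>r. real (r choose k) * b (Suc k))"
    by (simp add: sum.distrib algebra_simps)
  also have "b 0 + (\<Sum>k\<le>r. real (r choose Suc k) * b (Suc k)) = (\<Sum>k\<le>Suc r. real (r choose k) * b k)"
    by (subst sum.atMost_Suc_shift) simp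
  also have "(\<Sum>k\<le>r. real (r choose k) * b (Suc k)) = (\<Sum>k\<le>r. real (r choose k) * a k)"
    by (simp add: a_def b_def)
  finally show ?thesis using sh id by simp
qed

text \<open>
  Differencing commutes with differentiation, so each of the \<open>r\<close> differences can be traded for a
  factor \<open>\<bar>h\<bar>\<close> and one more derivative by the mean value theorem.
\<close>

lemma fdiff_smooth_bound:
  assumes "\<And>i x. i < r \<Longrightarrow> (D i has_real_derivative D (Suc i) x) (at x)"
    and "\<And>x. \<bar>D r x\<bar> \<le> B"
  shows "\<bar>fdiff r h (D 0) x\<bar> \<le> \<bar>h\<bar> ^ r * B"
  using assms
proof (induction r arbitrary: D x)
  case 0
  then show ?case by (simp add: fdiff_def)
next
  case (Suc r)
  have deriv: "(fdiff r h (D 0) has_real_derivative fdiff r h (D 1) u) (at u)" for u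
    unfolding fdiff_def[abs_def]
    by (intro DERIV_sum DERIV_cmult DERIV_shift[THEN iffD1])
      (use Suc.prems(1)[of 0] in auto)
  have bd: "norm (fdiff r h (D 1) u) \<le> \<bar>h\<bar> ^ r * B" for u
    using Suc.IH[of "\<lambda>i. D (Suc i)" u] Suc.prems by simp
  have "norm (fdiff r h (D 0) (x + h) - fdiff r h (D 0) x) \<le> (\<bar>h\<bar> ^ r * B) * norm (x + h - x)"
    by (rule field_differentiable_bound[of UNIV _ "fdiff r h (D 1)"]) (use deriv bd in auto)
  then show ?case by (simp add: fdiff_Suc mult_ac)
qed

lemma fdiff_crude_bound:
  assumes "\<And>x. \<bar>g x\<bar> \<le> B"
  shows "\<bar>fdiff r h g x\<bar> \<le> 2 ^ r * B"
proof -
  have "\<bar>fdiff r h g x\<bar> \<le> (\<Sum>k\<le>r. real (r choose k) * B)"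
    unfolding fdiff_def using assms
    by (intro order.trans[OF sum_abs] sum_mono) (simp add: abs_mult mult_left_mono)
  also have "\<dots> = 2 ^ r * B"
    by (simp flip: sum_distrib_right of_nat_sum add: choose_row_sum)
  finally show ?thesis .
qed

lemma fdiff_add_const: "0 < r \<Longrightarrow> fdiff r h (\<lambda>x. c + g x) x = fdiff r h g x"
proof -
  assume "0 < r"
  have "fdiff r h (\<lambda>_. c) x = 0"
    using fdiff_smooth_bound[of r "\<lambda>i _. if i = 0 then c else 0" 0 h x] \<open>0 < r\<close> by simp
  then show ?thesis
    by (simp add: fdiff_def ring_distribs sum.distrib)
qed

text \<open>
  A function that varies at the length scale \<open>s\<close> is Hoelder of every order \<open>\<alpha> < r\<close>, at that scale. For
  steps shorter than \<open>s\<close> the bound from \<open>r\<close> derivatives is stronger than needed, for longer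
  steps boundedness suffices.
\<close>

lemma fdiff_holder_bound:
  fixes \<alpha> h s :: real
  assumes "0 < s" "0 < \<alpha>" "\<alpha> < real r" "0 \<le> B"
    and D: "\<And>i x. i < r \<Longrightarrow> (D i has_real_derivative D (Suc i) x) (at x)"
    and Dr: "\<And>x. \<bar>D r x\<bar> \<le> B / s ^ r" and D0: "\<And>x. \<bar>D 0 x\<bar> \<le> B"
  shows "\<bar>fdiff r h (D 0) x\<bar> \<le> 2 ^ r * B * (\<bar>h\<bar> / s) powr \<alpha>"
proof (cases "h = 0")
  case True
  have "0 < r" using assms by linarith
  with True fdiff_smooth_bound[OF D Dr, of h x] show ?thesis by (simp add: zero_power)
next
  case False
  define q where "q = \<bar>h\<bar> / s"
  have q: "0 < q" using False assms by (simp add: q_def)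
  show ?thesis
  proof (cases "q \<le> 1")
    case True
    have "\<bar>fdiff r h (D 0) x\<bar> \<le> \<bar>h\<bar> ^ r * (B / s ^ r)"
      by (rule fdiff_smooth_bound[OF D Dr])
    also have "\<dots> = B * q powr r"
      using q by (simp add: powr_realpow power_divide q_def)
    also have "\<dots> \<le> B * q powr \<alpha>"
      using True q assms by (intro mult_left_mono powr_mono') auto
    also have "\<dots> \<le> 2 ^ r * (B * q powr \<alpha>)"
      using mult_right_mono[of 1 "2 ^ r" "B * q powr \<alpha>"] assms by simp
    finally show ?thesis by (simp add: q_def)
  next
    case False
    then have "1 \<le> q powr \<alpha>" using assms by (intro ge_one_powr_ge_zero) auto
    with assms have "2 ^ r * B \<le> 2 ^ r * B * q powr \<alpha>"
      using mult_left_mono[of 1 "q powr \<alpha>" "2 ^ r * B"] by simp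
    with fdiff_crude_bound[of "D 0" B r h x, OF D0] show ?thesis
      unfolding q_def by (rule order.trans)
  qed
qed

section \<open>A smooth bump with mean zero\<close>

text \<open>
  Multiples of a power of this function by polynomials are closed under differentiation, which costs
  one power. They are thus compactly supported functions with any prescribed number of derivatives.
\<close>

definition arch :: "real \<Rightarrow> real" where
  "arch u = max 0 (u * (1 - u))"

text \<open>
  At zero both one-sided derivatives vanish, which is why the exponent has to be at least two.
\<close>

lemma DERIV_pos_part_power:
  "((\<lambda>v::real. max 0 v ^ (k + 2)) has_real_derivative real (k + 2) * max 0 v ^ (k + 1)) (at v)"
proof -
  consider "v < 0" | "v = 0" | "0 < v" by linarith
  then show ?thesis
  proof cases
    case 1
    have "((\<lambda>v::real. 0) has_real_derivative 0) (at v)" by simp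
    then have "((\<lambda>v::real. max 0 v ^ (k + 2)) has_real_derivative 0) (at v)"
      by (rule has_field_derivative_transform_within_open[where S="{..<0}"]) (use 1 in auto)
    then show ?thesis using 1 by simp
  next
    case 2
    have "(\<lambda>h::real. max 0 h ^ (k + 1)) \<midarrow>0\<rightarrow> max 0 0 ^ (k + 1)"
      by (intro tendsto_intros)
    then have "(\<lambda>h::real. max 0 h ^ (k + 2) / h) \<midarrow>0\<rightarrow> max 0 0 ^ (k + 1)"
      by (rule Lim_transform_eventually) (auto simp: eventually_at_filter max_def)
    then have "(\<lambda>h::real. max 0 h ^ (k + 2) / h) \<midarrow>0\<rightarrow> 0"
      by simp
    then show ?thesis using 2 by (simp add: DERIV_def)
  next
    case 3
    have "((\<lambda>v::real. v ^ (k + 2)) has_real_derivative real (k + 2) * v ^ (k + 1)) (at v)"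
      by (rule DERIV_cong[OF DERIV_pow]) simp
    then have "((\<lambda>v::real. max 0 v ^ (k + 2)) has_real_derivative real (k + 2) * v ^ (k + 1)) (at v)"
      by (rule has_field_derivative_transform_within_open[where S="{0<..}"]) (use 3 in auto)
    then show ?thesis using 3 by simp
  qed
qed

lemma arch_power_Suc: "arch u ^ (k + 2) = arch u ^ (k + 1) * (u * (1 - u))"
  by (auto simp: arch_def max_def)

lemma arch_eq_0_iff: "arch u = 0 \<longleftrightarrow> u \<notin> {0<..<1}"
  using zero_less_mult_iff[of u "1 - u"] by (auto simp: arch_def max_def)

text \<open>
  The product rule leaves a term with the undiminished power of \<^const>\<open>arch\<close>; one factor of it may be
  replaced by the polynomial \<open>u (1 - u)\<close>, as the remaining ones vanish wherever the two differ.
\<close>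

lemma DERIV_arch_poly:
  "((\<lambda>u. arch u ^ (k + 2) * poly s u) has_real_derivative
     arch u ^ (k + 1) * poly (smult (real (k + 2)) ([:1, - 2:] * s) + [:0, 1, - 1:] * pderiv s) u) (at u)"
proof -
  have "((\<lambda>u. u * (1 - u)) has_real_derivative 1 - 2 * u) (at u)"
    by (auto intro!: derivative_eq_intros)
  from DERIV_chain2[OF DERIV_pos_part_power this, of k]
  have *: "((\<lambda>u. arch u ^ (k + 2)) has_real_derivative real (k + 2) * arch u ^ (k + 1) * (1 - 2 * u)) (at u)"
    by (simp add: arch_def)
  show ?thesis
    by (rule DERIV_cong[OF DERIV_mult[OF * poly_DERIV]], subst arch_power_Suc)
      (simp add: algebra_simps)
qed

lemma arch_poly_bounded: "\<exists>B. \<forall>u. \<bar>arch u ^ (k + 1) * poly s u\<bar> \<le> B"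
proof -
  have "compact ((\<lambda>u. arch u ^ (k + 1) * poly s u) ` {0..1})"
    unfolding arch_def by (intro compact_continuous_image continuous_intros compact_Icc)
  then have "bounded ((\<lambda>u. arch u ^ (k + 1) * poly s u) ` {0..1})"
    by (rule compact_imp_bounded)
  then obtain B where "\<And>u. u \<in> {0..1} \<Longrightarrow> \<bar>arch u ^ (k + 1) * poly s u\<bar> \<le> B"
    unfolding bounded_iff real_norm_def by blast
  then have "\<bar>arch u ^ (k + 1) * poly s u\<bar> \<le> max B 0" for u
    by (cases "arch u = 0") (use arch_eq_0_iff[of u] in \<open>auto simp: le_max_iff_disj\<close>)
  then show ?thesis by blast
qed

text \<open>
  Iterating the derivative gives a chain \<open>D\<close> whose member \<open>D i\<close> is the \<open>i\<close>-th derivative of \<open>D 0\<close>.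
\<close>

lemma arch_poly_derivatives:
  "\<exists>D. D 0 = (\<lambda>u. arch u ^ (m + 1) * poly s u) \<and>
     (\<forall>i<m. \<forall>u. (D i has_real_derivative D (Suc i) u) (at u)) \<and>
     (\<forall>i\<le>m. (\<forall>u. u \<notin> {0<..<1} \<longrightarrow> D i u = 0) \<and> (\<exists>B. \<forall>u. \<bar>D i u\<bar> \<le> B))"
proof (induction m arbitrary: s)
  case 0
  have "\<exists>B. \<forall>u. \<bar>arch u * poly s u\<bar> \<le> B" using arch_poly_bounded[of 0 s] by simp
  then show ?case
    by (intro exI[of _ "\<lambda>_ u. arch u * poly s u"]) (use arch_eq_0_iff in auto)
next
  case (Suc m)
  define s' where "s' = smult (real (m + 2)) ([:1, - 2:] * s) + [:0, 1, - 1:] * pderiv s"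
  obtain D where D: "D 0 = (\<lambda>u. arch u ^ (m + 1) * poly s' u)"
     "\<forall>i<m. \<forall>u. (D i has_real_derivative D (Suc i) u) (at u)"
     "\<forall>i\<le>m. (\<forall>u. u \<notin> {0<..<1} \<longrightarrow> D i u = 0) \<and> (\<exists>B. \<forall>u. \<bar>D i u\<bar> \<le> B)"
    using Suc[of s'] by blast
  define E where "E = case_nat (\<lambda>u. arch u ^ (m + 2) * poly s u) D"
  have "(E i has_real_derivative E (Suc i) u) (at u)" if "i < Suc m" for i u
    using that D(1,2) DERIV_arch_poly[of m s u]
    by (cases i) (auto simp: E_def s'_def)
  moreover have "(\<forall>u. u \<notin> {0<..<1} \<longrightarrow> E i u = 0) \<and> (\<exists>B. \<forall>u. \<bar>E i u\<bar> \<le> B)" if "i \<le> Suc m" for i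
    using that D(3) arch_eq_0_iff arch_poly_bounded[of "m + 1" s]
    by (cases i) (auto simp: E_def)
  ultimately show ?case
    by (intro exI[of _ E]) (simp add: E_def)
qed

lemma lborel_integral_odd_about_half:
  fixes g :: "real \<Rightarrow> real"
  assumes "\<And>u. g (1 - u) = - g u"
  shows "(\<integral>u. g u \<partial>lborel) = 0"
proof -
  have "(\<integral>u. g u \<partial>lborel) = (\<integral>u. g (1 - u) \<partial>lborel)"
    using lborel_integral_real_affine[of "-1" g 1] by simp
  also have "\<dots> = - (\<integral>u. g u \<partial>lborel)" using assms by simp
  finally show ?thesis by simp
qed

text \<open>
  The bump is \<open>(u (1 - u))\<^bsup>m + 1\<^esup> (1 - 2 u)\<close> on the unit interval: its last factor is odd
  about \<open>1 / 2\<close>, so that the mean is zero. The chain \<open>D\<close> consists of its derivatives.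
\<close>

lemma ex_smooth_mean_zero_bump:
  "\<exists>(D :: nat \<Rightarrow> real \<Rightarrow> real) B \<sigma>. 1 \<le> B \<and>
     (\<forall>i<m. \<forall>u. (D i has_real_derivative D (Suc i) u) (at u)) \<and>
     (\<forall>i\<le>m. \<forall>u. u \<notin> {0<..<1} \<longrightarrow> D i u = 0) \<and> (\<forall>i\<le>m. \<forall>u. \<bar>D i u\<bar> \<le> B) \<and>
     D 0 \<in> borel_measurable borel \<and>
     (\<integral>u. D 0 u \<partial>lborel) = 0 \<and> 0 < \<sigma> \<and> (\<integral>\<^sup>+u. ennreal ((D 0 u)\<^sup>2) \<partial>lborel) = ennreal \<sigma>"
proof -
  obtain D where D: "D 0 = (\<lambda>u. arch u ^ (m + 1) * poly [:1, - 2:] u)"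
     "\<forall>i<m. \<forall>u. (D i has_real_derivative D (Suc i) u) (at u)"
     "\<forall>i\<le>m. (\<forall>u. u \<notin> {0<..<1} \<longrightarrow> D i u = 0) \<and> (\<exists>B. \<forall>u. \<bar>D i u\<bar> \<le> B)"
    using arch_poly_derivatives[of m "[:1, - 2:]"] by blast
  then obtain B where B: "\<And>i u. i \<le> m \<Longrightarrow> \<bar>D i u\<bar> \<le> B i" by metis
  define B' where "B' = 1 + (\<Sum>i\<le>m. \<bar>B i\<bar>)"
  have bounded: "\<bar>D i u\<bar> \<le> B'" if "i \<le> m" for i u
  proof -
    have "\<bar>B i\<bar> \<le> (\<Sum>i\<le>m. \<bar>B i\<bar>)" by (rule member_le_sum) (use that in auto)
    with B[OF that, of u] show ?thesis by (simp add: B'_def)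
  qed
  have B'1: "1 \<le> B'" by (simp add: B'_def sum_nonneg)
  have meas: "D 0 \<in> borel_measurable borel"
    unfolding D(1) arch_def by (intro borel_measurable_continuous_onI continuous_intros)
  have mean: "(\<integral>u. D 0 u \<partial>lborel) = 0"
    by (rule lborel_integral_odd_about_half) (simp add: D(1) arch_def algebra_simps)
  have "0 < (\<integral>\<^sup>+u. ennreal ((D 0 u)\<^sup>2) \<partial>lborel)"
  proof -
    have "\<not> (AE u in lborel. ennreal ((D 0 u)\<^sup>2) = 0)"
    proof
      assume ae: "AE u in lborel. ennreal ((D 0 u)\<^sup>2) = 0"
      have "D 0 u \<noteq> 0" if "u \<in> {0<..<1/2}" for u
        using that arch_eq_0_iff[of u] by (simp add: D(1))
      then have "{0<..<1/2::real} \<subseteq> {u \<in> space lborel. \<not> ennreal ((D 0 u)\<^sup>2) = 0}"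
        by (auto simp: ennreal_eq_0_iff)
      moreover have "emeasure lborel {u \<in> space lborel. \<not> ennreal ((D 0 u)\<^sup>2) = 0} = 0"
        by (subst AE_iff_measurable[THEN iffD1, OF _ refl ae]) (use meas in auto)
      moreover have "{u \<in> space lborel. \<not> ennreal ((D 0 u)\<^sup>2) = 0} \<in> sets lborel" using meas by measurable
      ultimately have "emeasure lborel {0<..<1/2::real} \<le> 0"
        using emeasure_mono[of "{0<..<1/2::real}" "{u \<in> space lborel. \<not> ennreal ((D 0 u)\<^sup>2) = 0}" lborel]
        by simp
      then show False by simp
    qed
    then show ?thesis using nn_integral_0_iff_AE[of "\<lambda>u. ennreal ((D 0 u)\<^sup>2)" lborel] meas
      by (auto simp: zero_less_iff_neq_zero)
  qed
  moreover have "(\<integral>\<^sup>+u. ennreal ((D 0 u)\<^sup>2) \<partial>lborel) < \<infinity>"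
  proof -
    have "(\<integral>\<^sup>+u. ennreal ((D 0 u)\<^sup>2) \<partial>lborel) \<le> (\<integral>\<^sup>+u. ennreal (B'\<^sup>2) * indicator {0..1::real} u \<partial>lborel)"
    proof (rule nn_integral_mono)
      fix u
      have "(D 0 u)\<^sup>2 \<le> B'\<^sup>2"
        using bounded[of 0 u] by (simp add: abs_le_square_iff[symmetric])
      moreover have "u \<notin> {0..1} \<Longrightarrow> D 0 u = 0" using D(3) by auto
      ultimately show "ennreal ((D 0 u)\<^sup>2) \<le> ennreal (B'\<^sup>2) * indicator {0..1} u"
        by (auto simp: ennreal_leI split: split_indicator)
    qed
    also have "\<dots> < \<infinity>" by (simp add: nn_integral_cmult)
    finally show ?thesis .
  qed
  ultimately obtain \<sigma> where "0 < \<sigma>" and "(\<integral>\<^sup>+u. ennreal ((D 0 u)\<^sup>2) \<partial>lborel) = ennreal \<sigma>"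
    by (cases "\<integral>\<^sup>+u. ennreal ((D 0 u)\<^sup>2) \<partial>lborel") auto
  moreover have "\<forall>i\<le>m. \<forall>u. \<bar>D i u\<bar> \<le> B'" using bounded by blast
  moreover have "\<forall>i\<le>m. \<forall>u. u \<notin> {0<..<1} \<longrightarrow> D i u = 0" using D(3) by blast
  ultimately show ?thesis using B'1 meas mean D(2)
    by (intro exI[of _ D] exI[of _ B'] exI[of _ \<sigma>] conjI)
qed

section \<open>Besov norms from uniform bounds on differences\<close>

lemma L2_norm_on_le:
  assumes A: "A = {a1..b1} \<times> {a2..b2}" "a1 \<le> b1" "a2 \<le> b2" and D: "D \<subseteq> A"
    and g: "\<And>z. z \<in> D \<Longrightarrow> \<bar>g z\<bar> \<le> Q" and Q: "0 \<le> Q"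
  shows "L2_norm_on D g \<le> sqrt ((b1 - a1) * (b2 - a2)) * Q"
proof -
  have A_sets: "A \<in> sets lborel" and A_fin: "emeasure lborel A < \<infinity>"
    and A_meas: "measure lborel A = (b1 - a1) * (b2 - a2)"
  proof -
    have cb: "A = cbox (a1, a2) (b1, b2)" by (simp add: A cbox_Pair_eq)
    show "A \<in> sets lborel" by (simp add: cb)
    show "emeasure lborel A < \<infinity>" unfolding cb by (rule emeasure_lborel_cbox_finite)
    show "measure lborel A = (b1 - a1) * (b2 - a2)"
      using A(2,3) by (simp add: cb content_Pair content_real)
  qed
  \<comment> \<open>If the left-hand side is not integrable, its integral is \<open>0\<close> and the bound holds as well.\<close>
  have "(LINT z:D|lborel. (g z)\<^sup>2) \<le> (\<integral>z. indicator A z * Q\<^sup>2 \<partial>lborel)"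
    unfolding set_lebesgue_integral_def
  proof (rule integral_mono')
    show "integrable lborel (\<lambda>z. indicator A z * Q\<^sup>2)"
      by (intro integrable_mult_left integrable_real_indicator A_sets A_fin)
    fix z show "indicat_real D z *\<^sub>R (g z)\<^sup>2 \<le> indicator A z * Q\<^sup>2"
      using D g[of z] Q power_mono[of "\<bar>g z\<bar>" Q 2] by (auto split: split_indicator)
  qed simp
  also have "\<dots> = (b1 - a1) * (b2 - a2) * Q\<^sup>2"
    by (simp add: A_meas)
  finally have "L2_norm_on D g \<le> sqrt ((b1 - a1) * (b2 - a2) * Q\<^sup>2)"
    unfolding L2_norm_on_def by simp
  also have "\<dots> = sqrt ((b1 - a1) * (b2 - a2)) * Q"
    using Q by (simp add: real_sqrt_mult)
  finally show ?thesis .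
qed

lemma modulus_le:
  assumes A: "A = {a1..b1} \<times> {a2..b2}" "a1 \<le> b1" "a2 \<le> b2" and "0 < \<alpha>" "0 < t" "0 \<le> K"
    and g: "\<And>h z. z \<in> diff_domain A e r h \<Longrightarrow> \<bar>iterated_diff e r h g z\<bar> \<le> K * \<bar>h\<bar> powr \<alpha>"
  shows "t powr (- \<alpha>) * modulus A e r g t \<le> sqrt ((b1 - a1) * (b2 - a2)) * K"
proof -
  have "modulus A e r g t \<le> sqrt ((b1 - a1) * (b2 - a2)) * (K * t powr \<alpha>)"
    unfolding modulus_def
  proof (rule cSUP_least)
    show "{h. \<bar>h\<bar> \<le> t} \<noteq> {}" using \<open>0 < t\<close> by (auto intro!: exI[of _ 0])
    fix h assume "h \<in> {h. \<bar>h\<bar> \<le> t}"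
    then have h: "\<bar>h\<bar> powr \<alpha> \<le> t powr \<alpha>" using assms by (intro powr_mono2) auto
    show "L2_norm_on (diff_domain A e r h) (iterated_diff e r h g)
        \<le> sqrt ((b1 - a1) * (b2 - a2)) * (K * t powr \<alpha>)"
    proof (rule L2_norm_on_le[OF A])
      show "diff_domain A e r h \<subseteq> A"
        by (force simp: diff_domain_def)
      show "\<bar>iterated_diff e r h g z\<bar> \<le> K * t powr \<alpha>" if "z \<in> diff_domain A e r h" for z
        using g[OF that] mult_left_mono[OF h \<open>0 \<le> K\<close>] by simp
    qed (use \<open>0 \<le> K\<close> in simp)
  qed
  then have "t powr (- \<alpha>) * modulus A e r g t
      \<le> t powr (- \<alpha>) * (sqrt ((b1 - a1) * (b2 - a2)) * (K * t powr \<alpha>))"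
    by (rule mult_left_mono) simp
  also have "\<dots> = sqrt ((b1 - a1) * (b2 - a2)) * K * (t powr (- \<alpha>) * t powr \<alpha>)"
    by (simp add: mult_ac)
  also have "t powr (- \<alpha>) * t powr \<alpha> = 1"
    using \<open>0 < t\<close> by (simp flip: powr_add)
  finally show ?thesis by simp
qed

text \<open>
  Since \<open>A\<close> has finite area, uniform Hoelder bounds on the differences imply the Besov bound.
\<close>

lemma besov_norm_le:
  assumes A: "A = {a1..b1} \<times> {a2..b2}" "a1 \<le> b1" "a2 \<le> b2" and \<alpha>: "0 < \<alpha>1" "0 < \<alpha>2"
    and K: "0 \<le> Q" "0 \<le> K1" "0 \<le> K2"
    and g [measurable]: "g \<in> borel_measurable borel" and gQ: "\<And>z. z \<in> A \<Longrightarrow> \<bar>g z\<bar> \<le> Q"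
    and g1: "\<And>h z. z \<in> diff_domain A (1, 0) r1 h \<Longrightarrow> \<bar>iterated_diff (1, 0) r1 h g z\<bar> \<le> K1 * \<bar>h\<bar> powr \<alpha>1"
    and g2: "\<And>h z. z \<in> diff_domain A (0, 1) r2 h \<Longrightarrow> \<bar>iterated_diff (0, 1) r2 h g z\<bar> \<le> K2 * \<bar>h\<bar> powr \<alpha>2"
  shows "g \<in> besov_space \<alpha>1 \<alpha>2 r1 r2 A"
    and "besov_norm \<alpha>1 \<alpha>2 r1 r2 A g \<le> sqrt ((b1 - a1) * (b2 - a2)) * (Q + K1 + K2)"
proof -
  define s where "s = sqrt ((b1 - a1) * (b2 - a2))"
  have mod: "besov_modulus \<alpha>1 \<alpha>2 r1 r2 A g t \<le> s * K1 + s * K2" if "0 < t" for t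
    unfolding besov_modulus_def s_def
    by (intro add_mono modulus_le[OF A] that K \<alpha> g1 g2)
  have cb: "A = cbox (a1, a2) (b1, b2)" by (simp add: A cbox_Pair_eq)
  have [measurable]: "A \<in> sets borel" by (simp add: cb)
  have "set_integrable lborel A (\<lambda>z. (g z)\<^sup>2)"
    unfolding set_integrable_def
  proof (rule Bochner_Integration.integrable_bound)
    show "integrable lborel (\<lambda>z. indicator A z * Q\<^sup>2)"
      unfolding cb
      by (intro integrable_mult_left integrable_real_indicator emeasure_lborel_cbox_finite) simp
    show "AE z in lborel. norm (indicat_real A z *\<^sub>R (g z)\<^sup>2) \<le> norm (indicator A z * Q\<^sup>2)"
    proof (rule AE_I2)
      fix z show "norm (indicat_real A z *\<^sub>R (g z)\<^sup>2) \<le> norm (indicator A z * Q\<^sup>2)"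
        using gQ[of z] power_mono[of "\<bar>g z\<bar>" Q 2] by (auto split: split_indicator)
    qed
  qed measurable
  moreover have "(\<lambda>z. indicat_real A z *\<^sub>R g z) \<in> borel_measurable lborel" by measurable
  ultimately have "square_integrable_on A g"
    by (simp add: square_integrable_on_def set_borel_measurable_def)
  then show "g \<in> besov_space \<alpha>1 \<alpha>2 r1 r2 A"
    unfolding besov_space_def using mod by (auto intro!: bdd_aboveI2)
  have "L2_norm_on A g \<le> s * Q"
    unfolding s_def by (rule L2_norm_on_le[OF A]) (use gQ K in auto)
  moreover have "(SUP t\<in>{0<..}. besov_modulus \<alpha>1 \<alpha>2 r1 r2 A g t) \<le> s * K1 + s * K2"
    by (rule cSUP_least) (use mod in auto)
  ultimately show "besov_norm \<alpha>1 \<alpha>2 r1 r2 A g \<le> sqrt ((b1 - a1) * (b2 - a2)) * (Q + K1 + K2)"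
    unfolding besov_norm_def s_def[symmetric] by (simp add: ring_distribs)
qed

lemma iterated_diff_coordinate:
  "iterated_diff (1, 0) r h g (x, y) = fdiff r h (\<lambda>s. g (s, y)) x"
  "iterated_diff (0, 1) r h g (x, y) = fdiff r h (\<lambda>s. g (x, s)) y"
  by (simp_all add: iterated_diff_def fdiff_def)

section \<open>Small perturbations of an i.i.d. chain\<close>

lemma measurable_trans_kernel_subprob:
  "transition_density \<pi> \<Longrightarrow> trans_kernel \<pi> \<in> borel \<rightarrow>\<^sub>M subprob_algebra borel"
  by (intro measurable_prob_algebraD measurable_trans_kernel)

lemma transition_density_measurable:
  assumes "transition_density \<pi>"
  shows "(\<lambda>z. \<pi> z) \<in> borel_measurable (borel \<Otimes>\<^sub>M borel)"
  using assms by (simp add: transition_density_def borel_prod)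

lemma emeasure_trans_kernel:
  assumes "transition_density \<pi>" "B \<in> sets borel"
  shows "emeasure (trans_kernel \<pi> x) B = (\<integral>\<^sup>+y. ennreal (\<pi> (x, y)) * indicator B y \<partial>lborel)"
proof -
  note transition_density_measurable[OF assms(1), measurable]
  show ?thesis using assms(2) unfolding trans_kernel_def by (subst emeasure_density) auto
qed

lemma emeasure_bind_trans_kernel:
  assumes "transition_density \<pi>" "sets \<nu> = sets borel" "B \<in> sets borel"
  shows "emeasure (\<nu> \<bind> trans_kernel \<pi>) B = (\<integral>\<^sup>+x. emeasure (trans_kernel \<pi> x) B \<partial>\<nu>)"
proof (rule emeasure_bind)
  show "space \<nu> \<noteq> {}" using sets_eq_imp_space_eq[OF assms(2)] by simp
  show "trans_kernel \<pi> \<in> \<nu> \<rightarrow>\<^sub>M subprob_algebra borel"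
    using measurable_trans_kernel_subprob[OF assms(1)] measurable_cong_sets[OF assms(2) refl] by blast
qed fact

text \<open>
  One step of the chain makes every initial law absolutely continuous, with an explicit density. An
  invariant distribution therefore has a density that satisfies a pointwise fixed point equation.
\<close>

lemma bind_trans_kernel_eq_density:
  assumes \<pi>: "transition_density \<pi>" and s: "sets \<nu> = sets borel" and "sigma_finite_measure \<nu>"
  shows "\<nu> \<bind> trans_kernel \<pi> = density lborel (\<lambda>y. \<integral>\<^sup>+x. ennreal (\<pi> (x, y)) \<partial>\<nu>)"
proof (rule measure_eqI)
  note transition_density_measurable[OF \<pi>, measurable]
  note s[measurable_cong]
  interpret \<nu>: sigma_finite_measure \<nu> by fact
  interpret pair_sigma_finite \<nu> lborel by unfold_locales
  have K: "trans_kernel \<pi> \<in> \<nu> \<rightarrow>\<^sub>M subprob_algebra borel"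
    using measurable_trans_kernel_subprob[OF \<pi>] measurable_cong_sets[OF s refl] by blast
  have ne: "space \<nu> \<noteq> {}" using sets_eq_imp_space_eq[OF s] by simp
  have sb: "sets (\<nu> \<bind> trans_kernel \<pi>) = sets borel"
    by (rule sets_bind) (auto simp: trans_kernel_def ne)
  then show "sets (\<nu> \<bind> trans_kernel \<pi>) = sets (density lborel (\<lambda>y. \<integral>\<^sup>+x. ennreal (\<pi> (x, y)) \<partial>\<nu>))"
    by simp
  fix B assume "B \<in> sets (\<nu> \<bind> trans_kernel \<pi>)"
  then have [measurable]: "B \<in> sets borel" by (simp add: sb)
  have "emeasure (\<nu> \<bind> trans_kernel \<pi>) B
      = (\<integral>\<^sup>+x. \<integral>\<^sup>+y. ennreal (\<pi> (x, y)) * indicator B y \<partial>lborel \<partial>\<nu>)"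
    by (simp add: emeasure_bind_trans_kernel[OF \<pi> s] emeasure_trans_kernel[OF \<pi>])
  also have "\<dots> = (\<integral>\<^sup>+y. \<integral>\<^sup>+x. ennreal (\<pi> (x, y)) * indicator B y \<partial>\<nu> \<partial>lborel)"
    by (rule Fubini'[symmetric]) measurable
  also have "\<dots> = (\<integral>\<^sup>+y. (\<integral>\<^sup>+x. ennreal (\<pi> (x, y)) \<partial>\<nu>) * indicator B y \<partial>lborel)"
    by (intro nn_integral_cong nn_integral_multc) measurable
  finally show "emeasure (\<nu> \<bind> trans_kernel \<pi>) B
      = emeasure (density lborel (\<lambda>y. \<integral>\<^sup>+x. ennreal (\<pi> (x, y)) \<partial>\<nu>)) B"
    by (simp add: emeasure_density)
qed

lemma nstep_kernel_prob:
  assumes "transition_density \<pi>"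
  shows "nstep_kernel \<pi> n x \<in> space (prob_algebra borel)"
proof (induction n)
  case 0
  then show ?case by (simp add: nstep_kernel_def space_prob_algebra prob_space_return)
next
  case (Suc n)
  have "nstep_kernel \<pi> (Suc n) x = nstep_kernel \<pi> n x \<bind> trans_kernel \<pi>"
    by (simp add: nstep_kernel_def)
  with prob_space_bind'[OF Suc measurable_trans_kernel[OF assms]]
    sets_bind'[OF Suc measurable_trans_kernel[OF assms]]
  show ?case by (simp add: space_prob_algebra)
qed

text \<open>
  From any state the chain draws its next state from the density \<open>f\<close>, corrected by a small kernel \<open>p\<close>.
  The condition \<open>p_right\<close> preserves total mass and \<open>p_left\<close> preserves \<open>f\<close> as stationary density. By
  \<open>p_le\<close> all transition probabilities lie between one half and three halves of those of \<open>f\<close>, which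
  is a Doeblin condition.
\<close>

locale perturbed_iid =
  fixes f :: "real \<Rightarrow> real" and p :: "real \<times> real \<Rightarrow> real"
  assumes f_meas [measurable]: "f \<in> borel_measurable borel"
    and f_nonneg: "0 \<le> f y"
    and f_prob: "(\<integral>\<^sup>+y. ennreal (f y) \<partial>lborel) = 1"
    and p_borel: "p \<in> borel_measurable borel"
    and p_le: "\<bar>p (x, y)\<bar> \<le> f y / 2"
    and p_right: "(\<integral>y. p (x, y) \<partial>lborel) = 0"
    and p_left: "(\<integral>x. f x * p (x, y) \<partial>lborel) = 0"
begin

definition \<pi> :: "real \<times> real \<Rightarrow> real" where
  "\<pi> z = f (snd z) + p z"

lemma p_meas [measurable]: "p \<in> borel_measurable (borel \<Otimes>\<^sub>M borel)"
  using p_borel by (simp add: borel_prod)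

lemma \<pi>_bounds: "f y / 2 \<le> \<pi> (x, y)" "\<pi> (x, y) \<le> 3 / 2 * f y"
  using p_le[of x y] by (auto simp: \<pi>_def)

lemma \<pi>_nonneg: "0 \<le> \<pi> z"
  using \<pi>_bounds(1)[of "snd z" "fst z"] f_nonneg[of "snd z"] by simp

lemma \<pi>_meas [measurable]: "\<pi> \<in> borel_measurable (borel \<Otimes>\<^sub>M borel)"
  unfolding \<pi>_def[abs_def] by measurable

lemma integrable_f: "integrable lborel f"
  by (rule integrableI_nonneg) (auto simp: f_nonneg f_prob)

lemma integral_f: "(\<integral>y. f y \<partial>lborel) = 1"
  using f_prob by (subst integral_eq_nn_integral) (auto simp: f_nonneg)

lemma integrable_p: "integrable lborel (\<lambda>y. p (x, y))"
proof (rule Bochner_Integration.integrable_bound[OF integrable_f])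
  show "AE y in lborel. norm (p (x, y)) \<le> norm (f y)"
  proof (rule AE_I2)
    fix y show "norm (p (x, y)) \<le> norm (f y)" using p_le[of x y] f_nonneg[of y] by simp
  qed
qed measurable

lemma integrable_f_p: "integrable lborel (\<lambda>x. f x * p (x, y))"
proof (rule Bochner_Integration.integrable_bound)
  show "integrable lborel (\<lambda>x. f x * (f y / 2))" by (intro integrable_mult_left integrable_f)
  show "AE x in lborel. norm (f x * p (x, y)) \<le> norm (f x * (f y / 2))"
  proof (rule AE_I2)
    fix x show "norm (f x * p (x, y)) \<le> norm (f x * (f y / 2))"
      using mult_left_mono[OF p_le[of x y] f_nonneg[of x]] f_nonneg by (simp add: abs_mult)
  qed
qed measurable

lemma transition_density_\<pi>: "transition_density \<pi>"
proof -
  have "(\<integral>\<^sup>+y. ennreal (\<pi> (x, y)) \<partial>lborel) = 1" for x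
  proof -
    have "(\<integral>\<^sup>+y. ennreal (\<pi> (x, y)) \<partial>lborel) = ennreal (\<integral>y. \<pi> (x, y) \<partial>lborel)"
      by (rule nn_integral_eq_integral) (auto simp: \<pi>_nonneg, simp add: \<pi>_def integrable_f integrable_p)
    also have "(\<integral>y. \<pi> (x, y) \<partial>lborel) = 1"
      by (simp add: \<pi>_def integrable_f integrable_p integral_f p_right)
    finally show ?thesis by simp
  qed
  then show ?thesis
    using \<pi>_meas by (auto simp: transition_density_def \<pi>_nonneg borel_prod)
qed

abbreviation F :: "real measure" where
  "F \<equiv> density lborel (\<lambda>y. ennreal (f y))"

lemma prob_space_F: "prob_space F"
  by standard (simp add: emeasure_density f_prob)

lemma invariant_F: "invariant_distribution \<pi> F"
proof -
  interpret F: prob_space F by (rule prob_space_F)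
  have eq: "(\<integral>\<^sup>+x. ennreal (\<pi> (x, y)) \<partial>F) = ennreal (f y)" for y
  proof -
    have "(\<integral>\<^sup>+x. ennreal (\<pi> (x, y)) \<partial>F) = (\<integral>\<^sup>+x. ennreal (f x * f y + f x * p (x, y)) \<partial>lborel)"
      by (subst nn_integral_density)
        (auto intro!: nn_integral_cong simp: ennreal_mult'[symmetric] f_nonneg \<pi>_def distrib_left)
    also have "\<dots> = ennreal (\<integral>x. f x * f y + f x * p (x, y) \<partial>lborel)"
    proof (rule nn_integral_eq_integral)
      show "integrable lborel (\<lambda>x. f x * f y + f x * p (x, y))"
        by (intro Bochner_Integration.integrable_add integrable_mult_left integrable_f integrable_f_p)
      show "AE x in lborel. 0 \<le> f x * f y + f x * p (x, y)"
        using mult_nonneg_nonneg[OF f_nonneg \<pi>_nonneg[of "(_, y)"]]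
        by (auto simp: \<pi>_def distrib_left)
    qed
    also have "(\<integral>x. f x * f y + f x * p (x, y) \<partial>lborel) = f y"
      by (subst Bochner_Integration.integral_add)
        (auto intro!: integrable_mult_left integrable_f integrable_f_p simp: integral_f p_left)
    finally show ?thesis .
  qed
  show ?thesis
    unfolding invariant_distribution_def
    by (simp add: prob_space_F bind_trans_kernel_eq_density[OF transition_density_\<pi>]
        F.sigma_finite_measure_axioms eq)
qed

text \<open>
  An invariant distribution has a density of the form \<open>f + h\<close>, where \<open>h\<close> satisfies
  \<open>h(y) = \<integral> h(x) p(x, y) dx\<close> because \<open>p\<close> annihilates \<open>f\<close>. As \<open>\<bar>p\<bar> \<le> f / 2\<close>, this equation halves
  every bound of the form \<open>\<bar>h\<bar> \<le> c f\<close>, so that \<open>h\<close> vanishes.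
\<close>

lemma invariant_unique:
  assumes "invariant_distribution \<pi> \<mu>"
  shows "\<mu> = F"
proof -
  have s [measurable_cong]: "sets \<mu> = sets borel" and "prob_space \<mu>" and inv: "\<mu> \<bind> trans_kernel \<pi> = \<mu>"
    using assms by (auto simp: invariant_distribution_def)
  interpret prob_space \<mu> by fact
  have sp: "space \<mu> = UNIV" using sets_eq_imp_space_eq[OF s] by simp
  have ip: "integrable \<mu> (\<lambda>x. p (x, y))" for y
  proof (rule integrable_const_bound)
    show "AE x in \<mu>. norm (p (x, y)) \<le> f y / 2" unfolding real_norm_def by (intro AE_I2 p_le)
  qed measurable
  define h where "h y = (\<integral>x. p (x, y) \<partial>\<mu>)" for y
  have h_meas [measurable]: "h \<in> borel_measurable borel"
    unfolding h_def[abs_def] by measurable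
  have h_le: "\<bar>h y\<bar> \<le> f y / 2" for y
  proof -
    have "\<bar>h y\<bar> \<le> (\<integral>x. \<bar>p (x, y)\<bar> \<partial>\<mu>)" unfolding h_def by (rule integral_abs_bound)
    also have "\<dots> \<le> (\<integral>x. f y / 2 \<partial>\<mu>)"
      by (intro integral_mono integrable_abs ip p_le) simp
    finally show ?thesis by (simp add: prob_space)
  qed
  have fh: "0 \<le> f y + h y" for y using h_le[of y] f_nonneg[of y] by simp
  have "(\<integral>\<^sup>+x. ennreal (\<pi> (x, y)) \<partial>\<mu>) = ennreal (f y + h y)" for y
  proof -
    have "(\<integral>\<^sup>+x. ennreal (\<pi> (x, y)) \<partial>\<mu>) = ennreal (\<integral>x. \<pi> (x, y) \<partial>\<mu>)"
      by (rule nn_integral_eq_integral) (auto simp: \<pi>_nonneg, simp add: \<pi>_def ip)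
    also have "(\<integral>x. \<pi> (x, y) \<partial>\<mu>) = f y + h y"
      using prob_space by (simp add: \<pi>_def ip h_def)
    finally show ?thesis .
  qed
  then have \<mu>: "\<mu> = density lborel (\<lambda>y. ennreal (f y + h y))"
    using bind_trans_kernel_eq_density[OF transition_density_\<pi> s sigma_finite_measure_axioms] inv by simp
  have hp_le: "\<bar>h x * p (x, y)\<bar> \<le> (f y / 2) * (f x / 2)" for x y
    using mult_mono[OF h_le[of x] p_le[of x y]] f_nonneg by (simp add: abs_mult mult_ac)
  have ihp: "integrable lborel (\<lambda>x. h x * p (x, y))" for y
  proof (rule Bochner_Integration.integrable_bound)
    show "integrable lborel (\<lambda>x. (f y / 2) * (f x / 2))" by (intro integrable_mult_right integrable_divide integrable_f)
    show "AE x in lborel. norm (h x * p (x, y)) \<le> norm ((f y / 2) * (f x / 2))"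
      using hp_le f_nonneg by (auto simp: abs_mult)
  qed measurable
  have h_eq: "h y = (\<integral>x. h x * p (x, y) \<partial>lborel)" for y
  proof -
    have "h y = (\<integral>x. (f x + h x) * p (x, y) \<partial>lborel)"
      unfolding h_def[of y] by (subst \<mu>, subst integral_density) (auto simp: fh)
    also have "\<dots> = (\<integral>x. f x * p (x, y) \<partial>lborel) + (\<integral>x. h x * p (x, y) \<partial>lborel)"
      by (simp add: distrib_right integrable_f_p ihp)
    finally show ?thesis by (simp add: p_left)
  qed
  have bound: "\<bar>h y\<bar> \<le> f y / 2 ^ k" for k y
  proof (induction k arbitrary: y)
    case 0
    show ?case using h_le[of y] f_nonneg[of y] by simp
  next
    case (Suc k)
    have "\<bar>h y\<bar> \<le> (\<integral>x. \<bar>h x * p (x, y)\<bar> \<partial>lborel)"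
      by (subst h_eq) (rule integral_abs_bound)
    also have "\<dots> \<le> (\<integral>x. f x * (f y / 2 ^ Suc k) \<partial>lborel)"
    proof (rule integral_mono)
      fix x show "\<bar>h x * p (x, y)\<bar> \<le> f x * (f y / 2 ^ Suc k)"
        using mult_mono[OF Suc[of x] p_le[of x y]] f_nonneg by (simp add: abs_mult)
    qed (intro integrable_abs ihp integrable_mult_left integrable_f)+
    finally show ?case by (simp add: integral_f)
  qed
  have "h y = 0" for y
  proof -
    have "(\<lambda>k. f y / 2 ^ k) \<longlonglongrightarrow> 0"
      by (intro LIMSEQ_divide_realpow_zero) simp
    then have "\<bar>h y\<bar> \<le> 0"
      by (rule LIMSEQ_le_const) (use bound in auto)
    then show ?thesis by simp
  qed
  then show ?thesis using \<mu> by simp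
qed

lemma stationary_\<pi>: "stationary_distribution \<pi> = F"
  unfolding stationary_distribution_def
  by (rule the_equality) (auto intro: invariant_F invariant_unique)

lemma kernel_bounds:
  assumes B [measurable]: "B \<in> sets borel"
  shows "ennreal (1 / 2) * emeasure F B \<le> emeasure (trans_kernel \<pi> x) B"
    and "emeasure (trans_kernel \<pi> x) B \<le> ennreal (3 / 2) * emeasure F B"
proof -
  have F: "ennreal c * emeasure F B = (\<integral>\<^sup>+y. ennreal (c * f y) * indicator B y \<partial>lborel)" if "0 \<le> c" for c
    using that by (simp add: emeasure_density ennreal_mult f_nonneg mult.assoc nn_integral_cmult)
  show "ennreal (1 / 2) * emeasure F B \<le> emeasure (trans_kernel \<pi> x) B"
    unfolding emeasure_trans_kernel[OF transition_density_\<pi> B] using \<pi>_bounds(1)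
    by (subst F) (auto intro!: nn_integral_mono mult_right_mono ennreal_leI)
  show "emeasure (trans_kernel \<pi> x) B \<le> ennreal (3 / 2) * emeasure F B"
    unfolding emeasure_trans_kernel[OF transition_density_\<pi> B] using \<pi>_bounds(2)
    by (subst F) (auto intro!: nn_integral_mono mult_right_mono ennreal_leI)
qed

text \<open>
  The bounds hold uniformly in the current state, so they survive any number of earlier steps. The lower
  one yields irreducibility and recurrence, the upper one maximality of the irreducibility measure.
\<close>

lemma nstep_bounds:
  assumes B: "B \<in> sets borel"
  shows "ennreal (1 / 2) * emeasure F B \<le> emeasure (nstep_kernel \<pi> (Suc n) x) B"
    and "emeasure (nstep_kernel \<pi> (Suc n) x) B \<le> ennreal (3 / 2) * emeasure F B"
proof -
  define \<nu> where "\<nu> = nstep_kernel \<pi> n x"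
  have "\<nu> \<in> space (prob_algebra borel)"
    unfolding \<nu>_def by (rule nstep_kernel_prob[OF transition_density_\<pi>])
  then have s: "sets \<nu> = sets borel" and "prob_space \<nu>" by (auto simp: space_prob_algebra)
  interpret \<nu>: prob_space \<nu> by fact
  have "nstep_kernel \<pi> (Suc n) x = \<nu> \<bind> trans_kernel \<pi>"
    by (simp add: nstep_kernel_def \<nu>_def)
  then have eq: "emeasure (nstep_kernel \<pi> (Suc n) x) B = (\<integral>\<^sup>+x. emeasure (trans_kernel \<pi> x) B \<partial>\<nu>)"
    by (simp add: emeasure_bind_trans_kernel[OF transition_density_\<pi> s B])
  have c: "(\<integral>\<^sup>+x. c \<partial>\<nu>) = c" for c by (simp add: \<nu>.emeasure_space_1)
  show "ennreal (1 / 2) * emeasure F B \<le> emeasure (nstep_kernel \<pi> (Suc n) x) B"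
    unfolding eq by (subst c[symmetric]) (intro nn_integral_mono kernel_bounds B)
  show "emeasure (nstep_kernel \<pi> (Suc n) x) B \<le> ennreal (3 / 2) * emeasure F B"
    unfolding eq by (subst c[symmetric]) (intro nn_integral_mono kernel_bounds B)
qed

lemma maximal_irreducibility_F: "maximal_irreducibility_measure \<pi> F"
  unfolding maximal_irreducibility_measure_def
proof (intro conjI allI impI)
  interpret F: prob_space F by (rule prob_space_F)
  have "emeasure (nstep_kernel \<pi> 1 x) B > 0" if "B \<in> sets borel" "emeasure F B > 0" for B x
  proof -
    have "0 < ennreal (1 / 2) * emeasure F B" using that unfolding ennreal_zero_less_mult_iff ennreal_less_zero_iff by simp
    also have "\<dots> \<le> emeasure (nstep_kernel \<pi> 1 x) B" using nstep_bounds(1)[OF that(1), of 0] by simp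
    finally show ?thesis .
  qed
  then show "irreducibility_measure \<pi> F"
    unfolding irreducibility_measure_def
    using F.emeasure_space_1 F.sigma_finite_measure_axioms by auto
next
  fix \<phi> assume \<phi>: "irreducibility_measure \<pi> \<phi>"
  show "absolutely_continuous F \<phi>"
    unfolding absolutely_continuous_def
  proof
    fix B assume "B \<in> null_sets F"
    then have B: "B \<in> sets borel" "emeasure F B = 0" by auto
    have "emeasure (nstep_kernel \<pi> n x) B = 0" if "n \<ge> 1" for n x
      using nstep_bounds(2)[OF B(1), of "n - 1" x] B(2) that by simp
    with \<phi> B show "B \<in> null_sets \<phi>"
      unfolding irreducibility_measure_def null_sets_def
      by (auto simp: zero_less_iff_neq_zero) (metis)
  qed
qed

lemma positive_recurrent_\<pi>: "positive_recurrent \<pi>"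
proof -
  have "(\<Sum>n. emeasure (nstep_kernel \<pi> (Suc n) x) B) = \<infinity>"
    if "B \<in> sets borel" "emeasure F B > 0" for B x
  proof -
    define c where "c = ennreal (1 / 2) * emeasure F B"
    have "0 < c" using that unfolding c_def ennreal_zero_less_mult_iff ennreal_less_zero_iff by simp
    have "(\<Sum>n. c) = (\<integral>\<^sup>+n. c \<partial>count_space (UNIV :: nat set))"
      by (rule nn_integral_count_space_nat[symmetric])
    also have "\<dots> = \<infinity>" using \<open>0 < c\<close> by (simp add: ennreal_mult_top)
    finally have "\<infinity> = (\<Sum>n. c)" by simp
    also have "(\<Sum>n. c) \<le> (\<Sum>n. emeasure (nstep_kernel \<pi> (Suc n) x) B)"
      unfolding c_def by (intro suminf_le nstep_bounds that) auto
    finally show ?thesis by (simp add: top_unique)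
  qed
  then show ?thesis
    unfolding positive_recurrent_def recurrent_def
    using maximal_irreducibility_F invariant_F by blast
qed

end

section \<open>The law of the observed path\<close>

lemma nn_integral_observation_law_0:
  assumes \<pi>: "transition_density \<pi>" "invariant_distribution \<pi> (stationary_distribution \<pi>)"
    and G [measurable]: "G \<in> borel_measurable (PiM {0..<1} (\<lambda>_. borel))"
  shows "(\<integral>\<^sup>+\<omega>. G \<omega> \<partial>observation_law \<pi> 0)
    = (\<integral>\<^sup>+x. G (fun_upd (\<lambda>_. undefined) 0 x) \<partial>stationary_distribution \<pi>)"
proof -
  interpret Ionescu_Tulcea "stationary_step \<pi>" "\<lambda>_. borel"
    by (rule Ionescu_Tulcea_stationary_step) fact+
  have u: "(\<lambda>_. undefined) \<in> space (PiM {0..<0 :: nat} (\<lambda>_. borel :: real measure))"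
    by (simp add: space_PiM)
  have "observation_law \<pi> 0 = eP 0 (\<lambda>_. undefined)"
    unfolding observation_law_def using bind_return[OF measurable_eP, OF u] by simp
  then show ?thesis
    using nn_integral_eP[OF u, of G] G by (simp add: stationary_step_def)
qed

text \<open>
  Integrals over paths are computed by integrating out the last observation, which is how all
  inductions on the number of observations proceed.
\<close>

lemma nn_integral_observation_law_Suc:
  assumes \<pi>: "transition_density \<pi>" "invariant_distribution \<pi> (stationary_distribution \<pi>)"
    and G [measurable]: "G \<in> borel_measurable (PiM {0..<Suc (Suc n)} (\<lambda>_. borel))"
  shows "(\<integral>\<^sup>+\<omega>. G \<omega> \<partial>observation_law \<pi> (Suc n))
    = (\<integral>\<^sup>+\<omega>. \<integral>\<^sup>+y. G (fun_upd \<omega> (Suc n) y) * ennreal (\<pi> (\<omega> n, y)) \<partial>lborel \<partial>observation_law \<pi> n)"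
proof -
  interpret Ionescu_Tulcea "stationary_step \<pi>" "\<lambda>_. borel"
    by (rule Ionescu_Tulcea_stationary_step) fact+
  note transition_density_measurable[OF \<pi>(1), measurable]
  have u: "(\<lambda>_. undefined) \<in> space (PiM {0..<0 :: nat} (\<lambda>_. borel :: real measure))"
    by (simp add: space_PiM)
  have eP: "eP (Suc n) \<in> C 0 (Suc n) (\<lambda>_. undefined) \<rightarrow>\<^sub>M
      subprob_algebra (PiM {0..<Suc (Suc n)} (\<lambda>_. borel))"
    using measurable_eP[of "Suc n"]
    by (subst measurable_cong_sets[OF sets_C[OF u, of "Suc n"] refl]) simp
  have "(\<integral>\<^sup>+\<omega>. G \<omega> \<partial>observation_law \<pi> (Suc n)) = (\<integral>\<^sup>+\<omega>. (\<integral>\<^sup>+z. G z \<partial>eP (Suc n) \<omega>) \<partial>observation_law \<pi> n)"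
    unfolding observation_law_def using nn_integral_bind[OF G eP]
    by (simp del: C.simps add: C.simps(2)[of 0 "Suc n"])
  also have "\<dots> = (\<integral>\<^sup>+\<omega>. \<integral>\<^sup>+y. G (fun_upd \<omega> (Suc n) y) * ennreal (\<pi> (\<omega> n, y)) \<partial>lborel \<partial>observation_law \<pi> n)"
  proof (rule nn_integral_cong)
    fix \<omega> assume "\<omega> \<in> space (observation_law \<pi> n)"
    then have \<omega>: "\<omega> \<in> space (PiM {0..<Suc n} (\<lambda>_. borel))"
      unfolding observation_law_def using space_C[OF u, of "n + 1"] by simp
    have [measurable]: "(\<lambda>y. G (fun_upd \<omega> (Suc n) y)) \<in> borel_measurable borel"
      by (rule measurable_compose[OF measurable_fun_upd[where J="{0..<Suc n}"] G])
        (use \<omega> in auto)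
    have "(\<integral>\<^sup>+z. G z \<partial>eP (Suc n) \<omega>) = (\<integral>\<^sup>+y. G (fun_upd \<omega> (Suc n) y) \<partial>trans_kernel \<pi> (\<omega> n))"
      using nn_integral_eP[OF \<omega> G] by (simp add: stationary_step_def)
    also have "\<dots> = (\<integral>\<^sup>+y. G (fun_upd \<omega> (Suc n) y) * ennreal (\<pi> (\<omega> n, y)) \<partial>lborel)"
      unfolding trans_kernel_def by (subst nn_integral_density) (auto simp: mult.commute)
    finally show "(\<integral>\<^sup>+z. G z \<partial>eP (Suc n) \<omega>) = \<dots>" .
  qed
  finally show ?thesis .
qed

lemma
  assumes \<pi>: "transition_density \<pi>" "invariant_distribution \<pi> (stationary_distribution \<pi>)"
  shows sets_observation_law: "sets (observation_law \<pi> n) = sets (PiM {0..<n + 1} (\<lambda>_. borel))"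
    and prob_space_observation_law: "prob_space (observation_law \<pi> n)"
proof -
  interpret Ionescu_Tulcea "stationary_step \<pi>" "\<lambda>_. borel"
    by (rule Ionescu_Tulcea_stationary_step) fact+
  have u: "(\<lambda>_. undefined) \<in> space (PiM {0..<0 :: nat} (\<lambda>_. borel :: real measure))"
    by (simp add: space_PiM)
  show "sets (observation_law \<pi> n) = sets (PiM {0..<n + 1} (\<lambda>_. borel))"
    and "prob_space (observation_law \<pi> n)"
    unfolding observation_law_def using sets_C[OF u, of "n + 1"] prob_space_C[OF u, of "n + 1"] by simp_all
qed

definition path_lr :: "(real \<times> real \<Rightarrow> real) \<Rightarrow> nat \<Rightarrow> (nat \<Rightarrow> real) \<Rightarrow> ennreal" where
  "path_lr \<rho> n \<omega> = (\<Prod>i<n. ennreal (\<rho> (\<omega> i, \<omega> (Suc i))))"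

lemma path_lr_Suc_upd:
  "path_lr \<rho> (Suc n) (fun_upd \<omega> (Suc n) y) = path_lr \<rho> n \<omega> * ennreal (\<rho> (\<omega> n, y))"
proof -
  have "path_lr \<rho> n (fun_upd \<omega> (Suc n) y) = path_lr \<rho> n \<omega>"
    unfolding path_lr_def by (intro prod.cong) auto
  then show ?thesis by (simp add: path_lr_def)
qed

lemma measurable_path_lr [measurable]:
  assumes [measurable]: "\<rho> \<in> borel_measurable (borel \<Otimes>\<^sub>M borel)"
  shows "path_lr \<rho> n \<in> borel_measurable (PiM {0..<Suc n} (\<lambda>_. borel))"
  unfolding path_lr_def[abs_def]
proof (rule borel_measurable_prod_ennreal)
  fix i assume "i \<in> {..<n}"
  then have [measurable]: "(\<lambda>\<omega>. \<omega> i) \<in> borel_measurable (PiM {0..<Suc n} (\<lambda>_. borel :: real measure))"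
    "(\<lambda>\<omega>. \<omega> (Suc i)) \<in> borel_measurable (PiM {0..<Suc n} (\<lambda>_. borel :: real measure))"
    by (auto intro!: measurable_component_singleton)
  show "(\<lambda>\<omega>. ennreal (\<rho> (\<omega> i, \<omega> (Suc i)))) \<in> borel_measurable (PiM {0..<Suc n} (\<lambda>_. borel))"
    by measurable
qed

section \<open>Risk of an estimator\<close>

lemma estimator_measurable:
  assumes "T \<in> estimators n"
  shows "(\<lambda>(\<omega>, z). T \<omega> z) \<in> borel_measurable (PiM {0..<Suc n} (\<lambda>_. borel) \<Otimes>\<^sub>M lborel)"
  using assms by (simp add: estimators_def cong: measurable_cong_sets)

lemma loss_measurable:
  assumes T: "T \<in> estimators n" and [measurable]: "g \<in> borel_measurable borel" "R \<in> sets borel"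
  shows "(\<lambda>\<omega>. \<integral>\<^sup>+z\<in>R. ennreal ((T \<omega> z - g z)\<^sup>2) \<partial>lborel) \<in> borel_measurable (PiM {0..<Suc n} (\<lambda>_. borel))"
  supply estimator_measurable[OF T, measurable] by measurable

lemma estimator_section_measurable:
  assumes T: "T \<in> estimators n" and "\<omega> \<in> space (PiM {0..<Suc n} (\<lambda>_. borel))"
  shows "T \<omega> \<in> borel_measurable borel"
  using measurable_Pair2[OF estimator_measurable[OF T] assms(2)] by simp

text \<open>
  The squared loss is additive over disjoint sets, which localises the estimation problem to cells.
\<close>

lemma sum_quadratic_risk_le:
  assumes \<pi>: "transition_density \<pi>" "invariant_distribution \<pi> (stationary_distribution \<pi>)"
    and T: "T \<in> estimators n" and "finite C"
    and R: "\<And>c. c \<in> C \<Longrightarrow> R c \<in> sets borel" "\<And>c. c \<in> C \<Longrightarrow> R c \<subseteq> A"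
    and disj: "disjoint_family_on R C"
  shows "(\<Sum>c\<in>C. quadratic_risk (R c) n T \<pi>) \<le> quadratic_risk A n T \<pi>"
proof -
  have [measurable_cong]: "sets (observation_law \<pi> n) = sets (PiM {0..<Suc n} (\<lambda>_. borel))"
    using sets_observation_law[OF \<pi>] by simp
  have [measurable]: "\<pi> \<in> borel_measurable borel" using \<pi>(1) by (simp add: transition_density_def)
  have "(\<Sum>c\<in>C. quadratic_risk (R c) n T \<pi>)
      = (\<integral>\<^sup>+\<omega>. (\<Sum>c\<in>C. \<integral>\<^sup>+z\<in>R c. ennreal ((T \<omega> z - \<pi> z)\<^sup>2) \<partial>lborel) \<partial>observation_law \<pi> n)"
    unfolding quadratic_risk_def
  proof (rule nn_integral_sum[symmetric])
    fix c assume "c \<in> C"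
    with loss_measurable[OF T, of \<pi>] R(1)
    show "(\<lambda>\<omega>. \<integral>\<^sup>+z\<in>R c. ennreal ((T \<omega> z - \<pi> z)\<^sup>2) \<partial>lborel) \<in> borel_measurable (observation_law \<pi> n)"
      by (simp cong: measurable_cong_sets)
  qed
  also have "\<dots> \<le> quadratic_risk A n T \<pi>"
    unfolding quadratic_risk_def
  proof (rule nn_integral_mono)
    fix \<omega> assume "\<omega> \<in> space (observation_law \<pi> n)"
    then have "\<omega> \<in> space (PiM {0..<Suc n} (\<lambda>_. borel))"
      using sets_eq_imp_space_eq[OF sets_observation_law[OF \<pi>]] by simp
    note estimator_section_measurable[OF T this, measurable]
    have "(\<Sum>c\<in>C. \<integral>\<^sup>+z\<in>R c. ennreal ((T \<omega> z - \<pi> z)\<^sup>2) \<partial>lborel)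
        = (\<integral>\<^sup>+z. (\<Sum>c\<in>C. ennreal ((T \<omega> z - \<pi> z)\<^sup>2) * indicator (R c) z) \<partial>lborel)"
    proof (rule nn_integral_sum[symmetric])
      fix c assume "c \<in> C"
      note R(1)[OF this, measurable]
      show "(\<lambda>z. ennreal ((T \<omega> z - \<pi> z)\<^sup>2) * indicator (R c) z) \<in> borel_measurable lborel" by measurable
    qed
    also have "\<dots> = (\<integral>\<^sup>+z. ennreal ((T \<omega> z - \<pi> z)\<^sup>2) * indicator (\<Union>c\<in>C. R c) z \<partial>lborel)"
      by (simp add: indicator_UN_disjoint[OF \<open>finite C\<close> disj] sum_distrib_left)
    also have "\<dots> \<le> (\<integral>\<^sup>+z\<in>A. ennreal ((T \<omega> z - \<pi> z)\<^sup>2) \<partial>lborel)"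
      using R(2) by (intro nn_integral_mono mult_left_mono) (auto split: split_indicator)
    finally show "(\<Sum>c\<in>C. \<integral>\<^sup>+z\<in>R c. ennreal ((T \<omega> z - \<pi> z)\<^sup>2) \<partial>lborel)
        \<le> (\<integral>\<^sup>+z\<in>A. ennreal ((T \<omega> z - \<pi> z)\<^sup>2) \<partial>lborel)" .
  qed
  finally show ?thesis .
qed

section \<open>Two chains with a common stationary law\<close>

text \<open>
  Both chains start from the same stationary law, so the first observation contributes no factor to the
  likelihood ratio and only the ratio \<open>\<rho>\<close> of the transition densities matters.
\<close>

locale lr_pair =
  fixes \<pi> \<pi>' :: "real \<times> real \<Rightarrow> real" and \<rho> :: "real \<times> real \<Rightarrow> real"
  assumes td: "transition_density \<pi>" "transition_density \<pi>'"
    and inv: "invariant_distribution \<pi> (stationary_distribution \<pi>)"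
    and same: "invariant_distribution \<pi>' (stationary_distribution \<pi>')"
      "stationary_distribution \<pi>' = stationary_distribution \<pi>"
    and \<rho> [measurable]: "\<rho> \<in> borel_measurable (borel \<Otimes>\<^sub>M borel)"
    and \<rho>_nonneg: "0 \<le> \<rho> z"
    and \<rho>_eq: "\<pi>' z = \<rho> z * \<pi> z"
begin

lemma change_of_measure:
  assumes "G \<in> borel_measurable (PiM {0..<Suc n} (\<lambda>_. borel))"
  shows "(\<integral>\<^sup>+\<omega>. G \<omega> \<partial>observation_law \<pi>' n) = (\<integral>\<^sup>+\<omega>. G \<omega> * path_lr \<rho> n \<omega> \<partial>observation_law \<pi> n)"
  using assms
proof (induction n arbitrary: G)
  case 0
  then show ?case
    using nn_integral_observation_law_0[OF td(1) inv, of G] nn_integral_observation_law_0[OF td(2) same(1), of G]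
    by (simp add: path_lr_def same(2))
next
  case (Suc n)
  note Suc.prems[measurable]
  note transition_density_measurable[OF td(1), measurable]
  note transition_density_measurable[OF td(2), measurable]
  have n_meas: "(\<lambda>\<omega>. \<omega> n) \<in> borel_measurable (PiM {0..<Suc n} (\<lambda>_. borel :: real measure))"
    by (intro measurable_component_singleton) auto
  have upd [measurable]: "(\<lambda>(\<omega>, y). G (fun_upd \<omega> (Suc n) y))
      \<in> borel_measurable (PiM {0..<Suc n} (\<lambda>_. borel) \<Otimes>\<^sub>M lborel)"
    unfolding split_beta'
    by (rule measurable_compose[OF measurable_fun_upd[where J="{0..<Suc n}"] Suc.prems]) auto
  define H where "H \<omega> = (\<integral>\<^sup>+y. G (fun_upd \<omega> (Suc n) y) * ennreal (\<pi>' (\<omega> n, y)) \<partial>lborel)" for \<omega>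
  have H [measurable]: "H \<in> borel_measurable (PiM {0..<Suc n} (\<lambda>_. borel))"
    unfolding H_def[abs_def] supply n_meas[measurable] by measurable
  have sp: "space (observation_law \<pi> n) = space (PiM {0..<Suc n} (\<lambda>_. borel))"
    using sets_eq_imp_space_eq[OF sets_observation_law[OF td(1) inv]] by simp
  have "(\<integral>\<^sup>+\<omega>. G \<omega> \<partial>observation_law \<pi>' (Suc n)) = (\<integral>\<^sup>+\<omega>. H \<omega> \<partial>observation_law \<pi>' n)"
    unfolding H_def by (rule nn_integral_observation_law_Suc[OF td(2) same(1) Suc.prems])
  also have "\<dots> = (\<integral>\<^sup>+\<omega>. H \<omega> * path_lr \<rho> n \<omega> \<partial>observation_law \<pi> n)"
    by (rule Suc.IH) measurable
  also have "\<dots> = (\<integral>\<^sup>+\<omega>. \<integral>\<^sup>+y. G (fun_upd \<omega> (Suc n) y) * path_lr \<rho> (Suc n) (fun_upd \<omega> (Suc n) y)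
      * ennreal (\<pi> (\<omega> n, y)) \<partial>lborel \<partial>observation_law \<pi> n)"
  proof (rule nn_integral_cong)
    fix \<omega> assume "\<omega> \<in> space (observation_law \<pi> n)"
    then have \<omega>: "\<omega> \<in> space (PiM {0..<Suc n} (\<lambda>_. borel))" by (simp add: sp)
    define x where "x = \<omega> n"
    define g where "g y = G (fun_upd \<omega> (Suc n) y)" for y
    have [measurable]: "g \<in> borel_measurable borel"
      unfolding g_def[abs_def]
      by (rule measurable_compose[OF measurable_fun_upd[where J="{0..<Suc n}"] Suc.prems]) (use \<omega> in auto)
    have "H \<omega> * path_lr \<rho> n \<omega> = (\<integral>\<^sup>+y. g y * ennreal (\<pi>' (\<omega> n, y)) * path_lr \<rho> n \<omega> \<partial>lborel)"
      unfolding H_def g_def[symmetric] x_def[symmetric] by (rule nn_integral_multc[symmetric]) measurable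
    also have "\<dots> = (\<integral>\<^sup>+y. G (fun_upd \<omega> (Suc n) y) * path_lr \<rho> (Suc n) (fun_upd \<omega> (Suc n) y)
      * ennreal (\<pi> (\<omega> n, y)) \<partial>lborel)"
    proof (intro nn_integral_cong)
      fix y
      have "ennreal (\<pi>' (\<omega> n, y)) = ennreal (\<rho> (\<omega> n, y)) * ennreal (\<pi> (\<omega> n, y))"
        unfolding \<rho>_eq by (intro ennreal_mult' \<rho>_nonneg)
      then show "g y * ennreal (\<pi>' (\<omega> n, y)) * path_lr \<rho> n \<omega>
          = G (fun_upd \<omega> (Suc n) y) * path_lr \<rho> (Suc n) (fun_upd \<omega> (Suc n) y) * ennreal (\<pi> (\<omega> n, y))"
        by (simp add: g_def path_lr_Suc_upd mult_ac)
    qed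
    finally show "H \<omega> * path_lr \<rho> n \<omega> = \<dots>" .
  qed
  also have "\<dots> = (\<integral>\<^sup>+\<omega>. G \<omega> * path_lr \<rho> (Suc n) \<omega> \<partial>observation_law \<pi> (Suc n))"
    by (rule nn_integral_observation_law_Suc[OF td(1) inv, symmetric]) measurable
  finally show ?case .
qed

lemma path_lr_mean: "(\<integral>\<^sup>+\<omega>. path_lr \<rho> n \<omega> \<partial>observation_law \<pi> n) = 1"
  using change_of_measure[of "\<lambda>_. 1" n] prob_space.emeasure_space_1[OF prob_space_observation_law[OF td(2) same(1)]]
  by simp

text \<open>
  The conditional second moment of \<open>\<rho>\<close> may exceed one by a large amount in a few rarely visited states.
  A uniform bound on it would be multiplied up over all steps. The weight \<open>w\<close> acts as a
  Lyapunov function instead: where the conditional second moment is large, \<open>w\<close> is large too, and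
  the expected weight after the step is small again.
\<close>

lemma path_lr_second_moment:
  fixes w :: "real \<Rightarrow> ennreal"
  assumes w [measurable]: "w \<in> borel_measurable borel"
    and step: "\<And>x. (\<integral>\<^sup>+y. w y * ennreal ((\<rho> (x, y))\<^sup>2 * \<pi> (x, y)) \<partial>lborel) \<le> q * w x"
  shows "(\<integral>\<^sup>+\<omega>. (path_lr \<rho> n \<omega>)\<^sup>2 * w (\<omega> n) \<partial>observation_law \<pi> n)
    \<le> q ^ n * (\<integral>\<^sup>+x. w x \<partial>stationary_distribution \<pi>)"
proof (induction n)
  case 0
  have "(\<lambda>\<omega>. w (\<omega> 0)) \<in> borel_measurable (PiM {0..<1 :: nat} (\<lambda>_. borel))"
    by (rule measurable_compose[OF measurable_component_singleton[of 0] w]) auto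
  from nn_integral_observation_law_0[OF td(1) inv this] show ?case
    by (simp add: path_lr_def)
next
  case (Suc n)
  note transition_density_measurable[OF td(1), measurable]
  have comp: "(\<lambda>\<omega>. \<omega> m) \<in> borel_measurable (PiM {0..<Suc m} (\<lambda>_. borel :: real measure))" for m
    by (intro measurable_component_singleton) auto
  have [measurable_cong]: "sets (observation_law \<pi> n) = sets (PiM {0..<Suc n} (\<lambda>_. borel))"
    using sets_observation_law[OF td(1) inv] by simp
  have "(\<integral>\<^sup>+\<omega>. (path_lr \<rho> (Suc n) \<omega>)\<^sup>2 * w (\<omega> (Suc n)) \<partial>observation_law \<pi> (Suc n))
      = (\<integral>\<^sup>+\<omega>. \<integral>\<^sup>+y. (path_lr \<rho> (Suc n) (fun_upd \<omega> (Suc n) y))\<^sup>2 * w y * ennreal (\<pi> (\<omega> n, y)) \<partial>lborel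
          \<partial>observation_law \<pi> n)"
    supply comp[of "Suc n", measurable] by (subst nn_integral_observation_law_Suc[OF td(1) inv]) auto
  also have "\<dots> \<le> (\<integral>\<^sup>+\<omega>. q * ((path_lr \<rho> n \<omega>)\<^sup>2 * w (\<omega> n)) \<partial>observation_law \<pi> n)"
  proof (rule nn_integral_mono)
    fix \<omega> :: "nat \<Rightarrow> real"
    define x where "x = \<omega> n"
    have "(\<integral>\<^sup>+y. (path_lr \<rho> (Suc n) (fun_upd \<omega> (Suc n) y))\<^sup>2 * w y * ennreal (\<pi> (\<omega> n, y)) \<partial>lborel)
        = (\<integral>\<^sup>+y. (path_lr \<rho> n \<omega>)\<^sup>2 * (w y * ennreal ((\<rho> (\<omega> n, y))\<^sup>2 * \<pi> (\<omega> n, y))) \<partial>lborel)"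
    proof (intro nn_integral_cong)
      fix y
      have "ennreal ((\<rho> (\<omega> n, y))\<^sup>2 * \<pi> (\<omega> n, y)) = (ennreal (\<rho> (\<omega> n, y)))\<^sup>2 * ennreal (\<pi> (\<omega> n, y))"
        by (simp add: power2_eq_square ennreal_mult' \<rho>_nonneg mult.assoc)
      then show "(path_lr \<rho> (Suc n) (fun_upd \<omega> (Suc n) y))\<^sup>2 * w y * ennreal (\<pi> (\<omega> n, y))
          = (path_lr \<rho> n \<omega>)\<^sup>2 * (w y * ennreal ((\<rho> (\<omega> n, y))\<^sup>2 * \<pi> (\<omega> n, y)))"
        by (simp add: path_lr_Suc_upd power2_eq_square mult_ac)
    qed
    also have "\<dots> = (path_lr \<rho> n \<omega>)\<^sup>2 * (\<integral>\<^sup>+y. w y * ennreal ((\<rho> (\<omega> n, y))\<^sup>2 * \<pi> (\<omega> n, y)) \<partial>lborel)"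
      unfolding x_def[symmetric] by (rule nn_integral_cmult) measurable
    also have "\<dots> \<le> (path_lr \<rho> n \<omega>)\<^sup>2 * (q * w (\<omega> n))"
      by (intro mult_left_mono step) simp
    finally show "(\<integral>\<^sup>+y. (path_lr \<rho> (Suc n) (fun_upd \<omega> (Suc n) y))\<^sup>2 * w y * ennreal (\<pi> (\<omega> n, y)) \<partial>lborel)
        \<le> q * ((path_lr \<rho> n \<omega>)\<^sup>2 * w (\<omega> n))" by (simp add: mult_ac)
  qed
  also have "\<dots> = q * (\<integral>\<^sup>+\<omega>. (path_lr \<rho> n \<omega>)\<^sup>2 * w (\<omega> n) \<partial>observation_law \<pi> n)"
    supply comp[of n, measurable] by (rule nn_integral_cmult) measurable
  also have "\<dots> \<le> q * (q ^ n * (\<integral>\<^sup>+x. w x \<partial>stationary_distribution \<pi>))"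
    by (intro mult_left_mono Suc.IH) simp
  finally show ?case by (simp add: mult_ac)
qed

text \<open>
  The overlap \<open>\<integral> min(1, l)\<close> of two laws with likelihood ratio \<open>l\<close> of mean one is bounded below through
  the second moment of \<open>l\<close>, because \<open>t l - t\<^sup>2 l\<^sup>2 / 4 \<le> min(1, l)\<close> for \<open>0 \<le> t \<le> 1\<close>. The value \<open>t = 2 / K\<close>
  maximises the resulting bound \<open>t - t\<^sup>2 K / 4\<close>.
\<close>

lemma path_lr_overlap:
  assumes "2 \<le> K" and sq: "(\<integral>\<^sup>+\<omega>. (path_lr \<rho> n \<omega>)\<^sup>2 \<partial>observation_law \<pi> n) \<le> ennreal K"
  shows "ennreal (1 / K) \<le> (\<integral>\<^sup>+\<omega>. min 1 (path_lr \<rho> n \<omega>) \<partial>observation_law \<pi> n)"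
proof -
  have [measurable_cong]: "sets (observation_law \<pi> n) = sets (PiM {0..<Suc n} (\<lambda>_. borel))"
    using sets_observation_law[OF td(1) inv] by simp
  define I where "I = (\<integral>\<^sup>+\<omega>. min 1 (path_lr \<rho> n \<omega>) \<partial>observation_law \<pi> n)"
  define t where "t = 2 / K"
  have t: "0 \<le> t" "t \<le> 1" using assms(1) by (auto simp: t_def)
  have pw: "ennreal t * path_lr \<rho> n \<omega> \<le> min 1 (path_lr \<rho> n \<omega>) + ennreal (t\<^sup>2 / 4) * (path_lr \<rho> n \<omega>)\<^sup>2" for \<omega>
  proof -
    define l where "l = (\<Prod>i<n. \<rho> (\<omega> i, \<omega> (Suc i)))"
    have l: "0 \<le> l" by (auto simp: l_def \<rho>_nonneg intro!: prod_nonneg)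
    have eq: "path_lr \<rho> n \<omega> = ennreal l" by (simp add: path_lr_def l_def prod_ennreal \<rho>_nonneg)
    have le: "t * l \<le> min 1 l + t\<^sup>2 / 4 * l\<^sup>2"
    proof (cases "l \<le> 1")
      case True
      have "t * l \<le> l" using t l mult_right_mono[of t 1 l] by simp
      then show ?thesis using True add_increasing2[of "t\<^sup>2 / 4 * l\<^sup>2" "t * l" l] by simp
    next
      case False
      \<comment> \<open>For \<open>l > 1\<close> the claim is \<open>t l \<le> 1 + (t l / 2)\<^sup>2\<close>.\<close>
      have "0 \<le> (1 - t * l / 2)\<^sup>2" by simp
      then show ?thesis using False by (simp add: power2_eq_square field_simps)
    qed
    define c where "c = t\<^sup>2 / 4"
    have c: "0 \<le> c" by (simp add: c_def)
    have "ennreal (t * l) \<le> ennreal (min 1 l + c * l\<^sup>2)"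
      using le unfolding c_def by (rule ennreal_leI)
    also have "\<dots> = min 1 (ennreal l) + ennreal c * (ennreal l)\<^sup>2"
      using c l by (subst ennreal_plus) (auto simp: ennreal_mult ennreal_power min_def)
    also have "ennreal (t * l) = ennreal t * ennreal l" using t l by (rule_tac ennreal_mult)
    finally show ?thesis unfolding eq c_def .
  qed
  have "ennreal t = (\<integral>\<^sup>+\<omega>. ennreal t * path_lr \<rho> n \<omega> \<partial>observation_law \<pi> n)"
    by (subst nn_integral_cmult) (auto simp: path_lr_mean)
  also have "\<dots> \<le> (\<integral>\<^sup>+\<omega>. min 1 (path_lr \<rho> n \<omega>) + ennreal (t\<^sup>2 / 4) * (path_lr \<rho> n \<omega>)\<^sup>2 \<partial>observation_law \<pi> n)"
    by (intro nn_integral_mono pw)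
  also have "\<dots> = I + ennreal (t\<^sup>2 / 4) * (\<integral>\<^sup>+\<omega>. (path_lr \<rho> n \<omega>)\<^sup>2 \<partial>observation_law \<pi> n)"
    unfolding I_def by (subst nn_integral_add) (auto simp: nn_integral_cmult)
  also have "\<dots> \<le> I + ennreal (t\<^sup>2 / 4) * ennreal K"
    by (intro add_left_mono mult_left_mono sq) simp
  also have "ennreal (t\<^sup>2 / 4) * ennreal K = ennreal (1 / K)"
    using assms(1) by (simp add: t_def ennreal_mult'[symmetric] power2_eq_square field_simps)
  finally have "ennreal t \<le> I + ennreal (1 / K)" .
  then have "ennreal t - ennreal (1 / K) \<le> I"
    by (simp add: ennreal_minus_le_iff add.commute)
  moreover have "ennreal t - ennreal (1 / K) = ennreal (1 / K)"
    using assms(1) by (subst ennreal_minus) (auto simp: t_def field_simps)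
  ultimately show ?thesis by (simp add: I_def)
qed

text \<open>
  On the common part of the two path laws the estimator returns the same value for both densities, so
  the two losses at a point add up to at least half the squared distance of the densities there.
\<close>

lemma two_point_risk:
  assumes T: "T \<in> estimators n" and R [measurable]: "R \<in> sets borel"
  shows "(\<integral>\<^sup>+z\<in>R. ennreal ((\<pi> z - \<pi>' z)\<^sup>2 / 2) \<partial>lborel) * (\<integral>\<^sup>+\<omega>. min 1 (path_lr \<rho> n \<omega>) \<partial>observation_law \<pi> n)
    \<le> quadratic_risk R n T \<pi> + quadratic_risk R n T \<pi>'"
proof -
  have [measurable_cong]: "sets (observation_law \<pi> n) = sets (PiM {0..<Suc n} (\<lambda>_. borel))"
    using sets_observation_law[OF td(1) inv] by simp
  have \<pi>_meas: "\<pi> \<in> borel_measurable borel" "\<pi>' \<in> borel_measurable borel"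
    using td by (auto simp: transition_density_def)
  define D where "D = (\<integral>\<^sup>+z\<in>R. ennreal ((\<pi> z - \<pi>' z)\<^sup>2 / 2) \<partial>lborel)"
  define G where "G g \<omega> = (\<integral>\<^sup>+z\<in>R. ennreal ((T \<omega> z - g z)\<^sup>2) \<partial>lborel)" for g \<omega>
  have G_meas: "G g \<in> borel_measurable (PiM {0..<Suc n} (\<lambda>_. borel))"
    if "g \<in> borel_measurable borel" for g
    unfolding G_def[abs_def] by (rule loss_measurable[OF T that R])
  note Gm = G_meas[OF \<pi>_meas(1), measurable] G_meas[OF \<pi>_meas(2), measurable]
  have sum: "D \<le> G \<pi> \<omega> + G \<pi>' \<omega>" if \<omega>: "\<omega> \<in> space (observation_law \<pi> n)" for \<omega>
  proof -
    have "\<omega> \<in> space (PiM {0..<Suc n} (\<lambda>_. borel))"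
      using \<omega> sets_eq_imp_space_eq[OF sets_observation_law[OF td(1) inv]] by simp
    note estimator_section_measurable[OF T this, measurable]
    note \<pi>_meas[measurable]
    have "D \<le> (\<integral>\<^sup>+z. ennreal ((T \<omega> z - \<pi> z)\<^sup>2) * indicator R z + ennreal ((T \<omega> z - \<pi>' z)\<^sup>2) * indicator R z \<partial>lborel)"
      unfolding D_def
    proof (rule nn_integral_mono)
      fix z
      have "(\<pi> z - \<pi>' z)\<^sup>2 / 2 \<le> (T \<omega> z - \<pi> z)\<^sup>2 + (T \<omega> z - \<pi>' z)\<^sup>2"
      proof -
        have "(T \<omega> z - \<pi> z)\<^sup>2 + (T \<omega> z - \<pi>' z)\<^sup>2 - (\<pi> z - \<pi>' z)\<^sup>2 / 2
            = ((T \<omega> z - \<pi> z) + (T \<omega> z - \<pi>' z))\<^sup>2 / 2"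
          by (simp add: power2_eq_square field_simps)
        also have "\<dots> \<ge> 0" by simp
        finally show ?thesis by simp
      qed
      then show "ennreal ((\<pi> z - \<pi>' z)\<^sup>2 / 2) * indicator R z
          \<le> ennreal ((T \<omega> z - \<pi> z)\<^sup>2) * indicator R z + ennreal ((T \<omega> z - \<pi>' z)\<^sup>2) * indicator R z"
        by (auto simp: ennreal_plus[symmetric] ennreal_leI simp del: ennreal_plus split: split_indicator)
    qed
    also have "\<dots> = G \<pi> \<omega> + G \<pi>' \<omega>"
      unfolding G_def by (subst nn_integral_add) auto
    finally show ?thesis .
  qed
  have "D * (\<integral>\<^sup>+\<omega>. min 1 (path_lr \<rho> n \<omega>) \<partial>observation_law \<pi> n)
      = (\<integral>\<^sup>+\<omega>. D * min 1 (path_lr \<rho> n \<omega>) \<partial>observation_law \<pi> n)"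
    by (rule nn_integral_cmult[symmetric]) measurable
  also have "\<dots> \<le> (\<integral>\<^sup>+\<omega>. G \<pi> \<omega> + G \<pi>' \<omega> * path_lr \<rho> n \<omega> \<partial>observation_law \<pi> n)"
  proof (rule nn_integral_mono)
    fix \<omega> assume "\<omega> \<in> space (observation_law \<pi> n)"
    then have "D * min 1 (path_lr \<rho> n \<omega>) \<le> (G \<pi> \<omega> + G \<pi>' \<omega>) * min 1 (path_lr \<rho> n \<omega>)"
      by (intro mult_right_mono sum) auto
    also have "\<dots> \<le> G \<pi> \<omega> * 1 + G \<pi>' \<omega> * path_lr \<rho> n \<omega>"
      unfolding distrib_right by (intro add_mono mult_left_mono) auto
    finally show "D * min 1 (path_lr \<rho> n \<omega>) \<le> G \<pi> \<omega> + G \<pi>' \<omega> * path_lr \<rho> n \<omega>" by simp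
  qed
  also have "\<dots> = (\<integral>\<^sup>+\<omega>. G \<pi> \<omega> \<partial>observation_law \<pi> n) + (\<integral>\<^sup>+\<omega>. G \<pi>' \<omega> * path_lr \<rho> n \<omega> \<partial>observation_law \<pi> n)"
    using Gm by (intro nn_integral_add) measurable
  also have "(\<integral>\<^sup>+\<omega>. G \<pi>' \<omega> * path_lr \<rho> n \<omega> \<partial>observation_law \<pi> n) = (\<integral>\<^sup>+\<omega>. G \<pi>' \<omega> \<partial>observation_law \<pi>' n)"
    by (rule change_of_measure[symmetric]) (rule Gm)
  finally show ?thesis
    by (simp add: quadratic_risk_def G_def D_def)
qed

end

section \<open>Averaging over a hypercube\<close>

text \<open>
  Assouad's averaging argument. For each coordinate \<open>c\<close> the vertices \<open>S\<close> of the hypercube split into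
  pairs that differ in \<open>c\<close> only, and each pair contributes at least \<open>\<beta>\<close> to the sum over all vertices.
  The average over the vertices is thus at least \<open>\<beta> / 2\<close> for each coordinate, and a common bound of
  the vertices is at least their average.
\<close>

lemma hypercube_average:
  fixes r :: "'a set \<Rightarrow> 'a \<Rightarrow> ennreal"
  assumes C: "finite C"
    and pair: "\<And>S c. S \<subseteq> C \<Longrightarrow> c \<in> C - S \<Longrightarrow> \<beta> \<le> r S c + r (insert c S) c"
    and le: "\<And>S. S \<subseteq> C \<Longrightarrow> (\<Sum>c\<in>C. r S c) \<le> s"
  shows "of_nat (card C) * \<beta> \<le> 2 * s"
proof -
  define N where "N = (2 :: nat) ^ card C"
  have half: "of_nat N * \<beta> \<le> 2 * (\<Sum>S\<in>Pow C. r S c)" if c: "c \<in> C" for c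
  proof -
    define P where "P = Pow (C - {c})"
    have P: "finite P" "card P * 2 = N"
      using C c by (auto simp: P_def N_def card_Pow card_Diff_singleton power_Suc2[symmetric]
          simp del: power_Suc intro!: arg_cong[where f="\<lambda>k. 2 ^ k"] Suc_pred card_gt_0_iff[THEN iffD2])
    have "Pow C = P \<union> insert c ` P"
      using Pow_insert[of c "C - {c}"] c by (simp add: P_def insert_absorb)
    moreover have "P \<inter> insert c ` P = {}" by (auto simp: P_def)
    moreover have "inj_on (insert c) P" by (auto simp: P_def inj_on_def)
    ultimately have "(\<Sum>S\<in>Pow C. r S c) = (\<Sum>S\<in>P. r S c + r (insert c S) c)"
      using P(1) by (simp add: sum.union_disjoint sum.reindex sum.distrib)
    also have "\<dots> \<ge> (\<Sum>S\<in>P. \<beta>)"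
      by (intro sum_mono pair) (use c in \<open>auto simp: P_def\<close>)
    finally have "2 * (of_nat (card P) * \<beta>) \<le> 2 * (\<Sum>S\<in>Pow C. r S c)"
      by (intro mult_left_mono) auto
    then show ?thesis by (simp flip: P(2) add: mult_ac)
  qed
  have "of_nat N * (of_nat (card C) * \<beta>) = (\<Sum>c\<in>C. of_nat N * \<beta>)"
    by (simp add: mult_ac)
  also have "\<dots> \<le> (\<Sum>c\<in>C. 2 * (\<Sum>S\<in>Pow C. r S c))"
    by (intro sum_mono half)
  also have "\<dots> = 2 * (\<Sum>S\<in>Pow C. \<Sum>c\<in>C. r S c)"
    by (subst sum.swap) (simp add: sum_distrib_left)
  also have "\<dots> \<le> 2 * (\<Sum>S\<in>Pow C. s)"
    by (intro mult_left_mono sum_mono le) auto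
  also have "\<dots> = of_nat N * (2 * s)"
    using C by (simp add: N_def card_Pow mult_ac)
  finally have "of_nat N * (of_nat (card C) * \<beta>) \<le> of_nat N * (2 * s)" .
  moreover have "(of_nat N :: ennreal) \<noteq> 0" "(of_nat N :: ennreal) \<noteq> \<top>"
    by (simp_all only: of_nat_eq_0_iff ennreal_of_nat_neq_top not_False_eq_True) (simp add: N_def)
  ultimately show ?thesis by (simp add: ennreal_mult_le_mult_iff)
qed

section \<open>A grid of bumps\<close>

text \<open>
  The affine coordinate in which the cells of the interval from \<open>a\<close> to \<open>b\<close> are the unit intervals
  from \<open>j\<close> to \<open>j + 1\<close>, for \<open>j < N\<close>.
\<close>

definition coord :: "real \<Rightarrow> real \<Rightarrow> nat \<Rightarrow> real \<Rightarrow> real" where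
  "coord a b N x = real N * (x - a) / (b - a)"

context
  fixes a b :: real and N :: nat
  assumes ab: "a < b" and N: "0 < N"
begin

lemma coord_affine: "coord a b N x - s = (- (real N * a / (b - a)) - s) + (real N / (b - a)) * x"
  by (simp add: coord_def right_diff_distrib diff_divide_distrib)

lemma coord_cell_unique:
  assumes "coord a b N x - real j \<in> {0<..<1}"
  shows "j = nat \<lfloor>coord a b N x\<rfloor>"
proof -
  have "\<lfloor>coord a b N x\<rfloor> = int j" by (rule floor_unique) (use assms in auto)
  then show ?thesis by simp
qed

lemma coord_cell_range:
  assumes "coord a b N x - real j \<in> {0<..<1}" "j < N"
  shows "x \<in> {a<..<b}"
proof -
  have "0 < coord a b N x" "coord a b N x < N" using assms by auto
  then show ?thesis using ab N by (simp add: coord_def zero_less_divide_iff zero_less_mult_iff divide_less_eq)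
qed

lemma nn_integral_coord:
  fixes g :: "real \<Rightarrow> ennreal"
  assumes "g \<in> borel_measurable borel"
  shows "(\<integral>\<^sup>+x. g (coord a b N x - s) \<partial>lborel) = ennreal ((b - a) / real N) * (\<integral>\<^sup>+u. g u \<partial>lborel)"
proof -
  define c where "c = real N / (b - a)"
  have c: "0 < c" using ab N by (simp add: c_def)
  have "(\<integral>\<^sup>+u. g u \<partial>lborel) = ennreal c * (\<integral>\<^sup>+x. g (coord a b N x - s) \<partial>lborel)"
    using nn_integral_real_affine[OF assms, of c "- (real N * a / (b - a)) - s"] c
    unfolding coord_affine c_def[symmetric] by simp
  moreover have "ennreal ((b - a) / real N) * ennreal c = 1"
    using ab N by (simp add: c_def ennreal_mult'[symmetric])
  ultimately show ?thesis by (simp flip: mult.assoc)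
qed

lemma integral_coord:
  fixes g :: "real \<Rightarrow> real"
  assumes "(\<integral>u. g u \<partial>lborel) = 0"
  shows "(\<integral>x. g (coord a b N x - s) \<partial>lborel) = 0"
  using lborel_integral_real_affine[of "real N / (b - a)" g "- (real N * a / (b - a)) - s"] ab N assms
  unfolding coord_affine by simp

lemma integrable_coord:
  fixes g :: "real \<Rightarrow> real"
  assumes "integrable lborel g"
  shows "integrable lborel (\<lambda>x. g (coord a b N x - s))"
  using lborel_integrable_real_affine[OF assms, of "real N / (b - a)" "- (real N * a / (b - a)) - s"] ab N
  unfolding coord_affine by simp

lemma DERIV_coord:
  assumes "\<And>u. (g has_real_derivative g' u) (at u)"
  shows "((\<lambda>x. g (coord a b N x - s)) has_real_derivative g' (coord a b N x - s) * (real N / (b - a))) (at x)"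
proof (rule DERIV_chain2[OF assms])
  show "((\<lambda>x. coord a b N x - s) has_real_derivative real N / (b - a)) (at x)"
    unfolding coord_affine using ab by (auto intro!: derivative_eq_intros)
qed

end

lemma measurable_coord [measurable]: "coord a b N \<in> borel_measurable borel"
  unfolding coord_def[abs_def] by measurable

locale cell_grid =
  fixes a1 b1 a2 b2 :: real and N1 N2 :: nat
  assumes ab1: "a1 < b1" and ab2: "a2 < b2" and N1: "0 < N1" and N2: "0 < N2"
begin

abbreviation "u \<equiv> coord a1 b1 N1"
abbreviation "v \<equiv> coord a2 b2 N2"

definition bump_sum :: "(real \<Rightarrow> real) \<Rightarrow> (real \<Rightarrow> real) \<Rightarrow> (nat \<times> nat) set \<Rightarrow> real \<times> real \<Rightarrow> real" where
  "bump_sum G H S z = (\<Sum>c\<in>S. G (u (fst z) - real (fst c)) * H (v (snd z) - real (snd c)))"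

definition cells :: "(nat \<times> nat) set" where
  "cells = {..<N1} \<times> {..<N2}"

text \<open>
  Open cells are disjoint, and the bumps vanish on the lines between them.
\<close>

definition cell :: "nat \<times> nat \<Rightarrow> (real \<times> real) set" where
  "cell c = {z. u (fst z) - real (fst c) \<in> {0<..<1} \<and> v (snd z) - real (snd c) \<in> {0<..<1}}"

lemma finite_cells: "finite cells" by (simp add: cells_def)

lemma cell_sets [measurable]: "cell c \<in> sets borel"
proof -
  have "cell c = {z \<in> space (borel \<Otimes>\<^sub>M borel).
      u (fst z) - real (fst c) \<in> {0<..<1} \<and> v (snd z) - real (snd c) \<in> {0<..<1}}"
    by (simp add: cell_def space_pair_measure)
  also have "\<dots> \<in> sets (borel \<Otimes>\<^sub>M borel)" by measurable
  finally show ?thesis unfolding borel_prod .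
qed

lemma cell_subset: "c \<in> cells \<Longrightarrow> cell c \<subseteq> {a1..b1} \<times> {a2..b2}"
  using coord_cell_range[OF ab1 N1] coord_cell_range[OF ab2 N2]
  by (force simp: cell_def cells_def)

lemma disjoint_cells: "disjoint_family_on cell S"
  unfolding disjoint_family_on_def
proof (intro ballI impI)
  fix c d :: "nat \<times> nat" assume "c \<noteq> d"
  have "c = d" if "z \<in> cell c" "z \<in> cell d" for z
    using that coord_cell_unique[OF ab1 N1, of "fst z"] coord_cell_unique[OF ab2 N2, of "snd z"]
    unfolding cell_def by (metis (mono_tags, lifting) mem_Collect_eq prod.expand)
  with \<open>c \<noteq> d\<close> show "cell c \<inter> cell d = {}" by blast
qed

lemma bump_sum_measurable:
  assumes [measurable]: "G \<in> borel_measurable borel" "H \<in> borel_measurable borel"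
  shows "bump_sum G H S \<in> borel_measurable borel"
proof -
  have "bump_sum G H S \<in> borel_measurable (borel \<Otimes>\<^sub>M borel)"
    unfolding bump_sum_def[abs_def] by measurable
  then show ?thesis by (simp add: borel_prod)
qed

context
  fixes G H :: "real \<Rightarrow> real"
  assumes G0: "\<And>s. s \<notin> {0<..<1} \<Longrightarrow> G s = 0" and H0: "\<And>s. s \<notin> {0<..<1} \<Longrightarrow> H s = 0"
begin

text \<open>
  At most one summand is nonzero at any point, so bounds on sums of bumps do not
  depend on the number of cells.
\<close>

lemma bump_sum_cases:
  assumes S: "finite S"
  shows "bump_sum G H S z = 0 \<or>
    (\<exists>c\<in>S. z \<in> cell c \<and> bump_sum G H S z = G (u (fst z) - real (fst c)) * H (v (snd z) - real (snd c)))"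
proof (cases "\<exists>c\<in>S. z \<in> cell c")
  case True
  then obtain c where c: "c \<in> S" "z \<in> cell c" by blast
  have "G (u (fst z) - real (fst d)) * H (v (snd z) - real (snd d)) = 0" if "d \<in> S - {c}" for d
  proof -
    have "z \<notin> cell d" using that c disjoint_cells[of "{c, d}"] by (auto simp: disjoint_family_on_def)
    then show ?thesis using G0 H0 by (auto simp: cell_def)
  qed
  then have "(\<Sum>d\<in>S - {c}. G (u (fst z) - real (fst d)) * H (v (snd z) - real (snd d))) = 0"
    by (intro sum.neutral) auto
  then have "bump_sum G H S z = G (u (fst z) - real (fst c)) * H (v (snd z) - real (snd c))"
    unfolding bump_sum_def by (subst sum.remove[OF S c(1)]) simp
  with c show ?thesis by blast
next
  case False
  then have "bump_sum G H S z = 0"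
    unfolding bump_sum_def using G0 H0 by (intro sum.neutral) (auto simp: cell_def)
  then show ?thesis ..
qed

lemma bump_sum_bound:
  assumes S: "finite S" and G: "\<And>s. \<bar>G s\<bar> \<le> B1" and H: "\<And>s. \<bar>H s\<bar> \<le> B2"
  shows "\<bar>bump_sum G H S z\<bar> \<le> B1 * B2"
proof -
  have B: "0 \<le> B1" "0 \<le> B2" using G[of 0] H[of 0] by auto
  from bump_sum_cases[OF S, of z] show ?thesis
    using B mult_mono[OF G H] by (auto simp: abs_mult)
qed

end

text \<open>
  A derivative along one axis acts on the corresponding factor of each bump and produces the inverse of
  the cell width in that direction, which is the length scale of \<open>fdiff_holder_bound\<close>.
\<close>

lemma fdiff_bump_sum:
  fixes D :: "nat \<Rightarrow> real \<Rightarrow> real"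
  assumes S: "finite S" and \<alpha>: "0 < \<alpha>" "\<alpha> < real r" and amp: "0 \<le> amp"
    and D: "\<And>i s. i < r \<Longrightarrow> (D i has_real_derivative D (Suc i) s) (at s)"
    and D0: "\<And>i s. i \<le> r \<Longrightarrow> s \<notin> {0<..<1} \<Longrightarrow> D i s = 0"
    and DB: "\<And>i s. i \<le> r \<Longrightarrow> \<bar>D i s\<bar> \<le> B"
  shows "\<bar>fdiff r h (\<lambda>x. amp * bump_sum (D 0) (D 0) S (x, y)) x\<bar>
      \<le> 2 ^ r * (amp * B\<^sup>2) * (\<bar>h\<bar> / ((b1 - a1) / real N1)) powr \<alpha>"
    and "\<bar>fdiff r h (\<lambda>y. amp * bump_sum (D 0) (D 0) S (x, y)) y\<bar>
      \<le> 2 ^ r * (amp * B\<^sup>2) * (\<bar>h\<bar> / ((b2 - a2) / real N2)) powr \<alpha>"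
proof -
  have ampB: "0 \<le> amp * B\<^sup>2" using amp by simp
  define E1 where "E1 i x = amp * (real N1 / (b1 - a1)) ^ i * bump_sum (D i) (D 0) S (x, y)" for i x
  define E2 where "E2 i y = amp * (real N2 / (b2 - a2)) ^ i * bump_sum (D 0) (D i) S (x, y)" for i y
  have b1: "\<bar>E1 i x\<bar> \<le> amp * B\<^sup>2 / ((b1 - a1) / real N1) ^ i" if "i \<le> r" for i x
  proof -
    have "\<bar>bump_sum (D i) (D 0) S (x, y)\<bar> \<le> B * B"
      by (rule bump_sum_bound) (use D0 DB S that in auto)
    from mult_left_mono[OF this, of "amp * (real N1 / (b1 - a1)) ^ i"] show ?thesis
      using amp ab1 by (simp add: E1_def abs_mult power2_eq_square power_divide field_simps)
  qed
  have b2: "\<bar>E2 i y\<bar> \<le> amp * B\<^sup>2 / ((b2 - a2) / real N2) ^ i" if "i \<le> r" for i y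
  proof -
    have "\<bar>bump_sum (D 0) (D i) S (x, y)\<bar> \<le> B * B"
      by (rule bump_sum_bound) (use D0 DB S that in auto)
    from mult_left_mono[OF this, of "amp * (real N2 / (b2 - a2)) ^ i"] show ?thesis
      using amp ab2 by (simp add: E2_def abs_mult power2_eq_square power_divide field_simps)
  qed
  have d1: "(E1 i has_real_derivative E1 (Suc i) x) (at x)" if "i < r" for i x
  proof -
    have "((\<lambda>x. bump_sum (D i) (D 0) S (x, y)) has_real_derivative
        (\<Sum>c\<in>S. D (Suc i) (u x - real (fst c)) * (real N1 / (b1 - a1)) * D 0 (v y - real (snd c)))) (at x)"
      unfolding bump_sum_def fst_conv snd_conv
      by (intro DERIV_sum DERIV_cmult_right DERIV_coord[OF ab1 N1] D that)
    from DERIV_cmult[OF this, of "amp * (real N1 / (b1 - a1)) ^ i"] show ?thesis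
      unfolding E1_def[abs_def] by (rule DERIV_cong) (simp add: bump_sum_def sum_distrib_left mult_ac)
  qed
  have d2: "(E2 i has_real_derivative E2 (Suc i) y) (at y)" if "i < r" for i y
  proof -
    have "((\<lambda>y. bump_sum (D 0) (D i) S (x, y)) has_real_derivative
        (\<Sum>c\<in>S. D 0 (u x - real (fst c)) * (D (Suc i) (v y - real (snd c)) * (real N2 / (b2 - a2))))) (at y)"
      unfolding bump_sum_def fst_conv snd_conv
      by (intro DERIV_sum DERIV_cmult DERIV_coord[OF ab2 N2] D that)
    from DERIV_cmult[OF this, of "amp * (real N2 / (b2 - a2)) ^ i"] show ?thesis
      unfolding E2_def[abs_def] by (rule DERIV_cong) (simp add: bump_sum_def sum_distrib_left mult_ac)
  qed
  have h: "0 < (b1 - a1) / real N1" "0 < (b2 - a2) / real N2" using ab1 ab2 N1 N2 by auto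
  have "\<bar>fdiff r h (E1 0) x\<bar> \<le> 2 ^ r * (amp * B\<^sup>2) * (\<bar>h\<bar> / ((b1 - a1) / real N1)) powr \<alpha>"
    by (rule fdiff_holder_bound[OF h(1) \<alpha> ampB d1 b1]) (use b1[of 0] in auto)
  then show "\<bar>fdiff r h (\<lambda>x. amp * bump_sum (D 0) (D 0) S (x, y)) x\<bar>
      \<le> 2 ^ r * (amp * B\<^sup>2) * (\<bar>h\<bar> / ((b1 - a1) / real N1)) powr \<alpha>" by (simp add: E1_def[abs_def])
  have "\<bar>fdiff r h (E2 0) y\<bar> \<le> 2 ^ r * (amp * B\<^sup>2) * (\<bar>h\<bar> / ((b2 - a2) / real N2)) powr \<alpha>"
    by (rule fdiff_holder_bound[OF h(2) \<alpha> ampB d2 b2]) (use b2[of 0] in auto)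
  then show "\<bar>fdiff r h (\<lambda>y. amp * bump_sum (D 0) (D 0) S (x, y)) y\<bar>
      \<le> 2 ^ r * (amp * B\<^sup>2) * (\<bar>h\<bar> / ((b2 - a2) / real N2)) powr \<alpha>" by (simp add: E2_def[abs_def])
qed

end

section \<open>A hypercube of transition densities\<close>

text \<open>
  The base density is uniform with height \<open>f0\<close> on an interval of length \<open>1 / f0\<close> centred at zero;
  \<open>in_range\<close> makes it constant on both sides of the rectangle. By \<open>amp_small\<close> the perturbation
  is at most half the base density.
\<close>

locale hypercube_model = cell_grid +
  fixes f0 amp B \<sigma> :: real and \<phi> :: "real \<Rightarrow> real"
  assumes f0: "0 < f0" and amp: "0 \<le> amp" and amp_small: "amp * B\<^sup>2 \<le> f0 / 2"
    and in_range: "{a1..b1} \<union> {a2..b2} \<subseteq> {- (1 / (2 * f0))..1 / (2 * f0)}"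
    and \<phi>_meas [measurable]: "\<phi> \<in> borel_measurable borel"
    and \<phi>_0: "\<And>s. s \<notin> {0<..<1} \<Longrightarrow> \<phi> s = 0"
    and \<phi>_le: "\<And>s. \<bar>\<phi> s\<bar> \<le> B"
    and \<phi>_mean: "(\<integral>s. \<phi> s \<partial>lborel) = 0"
    and \<sigma>: "0 < \<sigma>" "(\<integral>\<^sup>+s. ennreal ((\<phi> s)\<^sup>2) \<partial>lborel) = ennreal \<sigma>"
begin

definition f :: "real \<Rightarrow> real" where
  "f y = f0 * indicator {- (1 / (2 * f0))..1 / (2 * f0)} y"

definition pert :: "(nat \<times> nat) set \<Rightarrow> real \<times> real \<Rightarrow> real" where
  "pert S z = amp * bump_sum \<phi> \<phi> S z"

definition h1 :: real where "h1 = (b1 - a1) / real N1"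
definition h2 :: real where "h2 = (b2 - a2) / real N2"

lemma h_pos: "0 < h1" "0 < h2"
  using ab1 ab2 N1 N2 by (auto simp: h1_def h2_def)

lemma f_eq:
  assumes "z \<in> {a1..b1} \<times> {a2..b2}"
  shows "f (fst z) = f0" "f (snd z) = f0"
  using assms in_range by (auto simp: f_def subset_iff)

lemma f_le: "f y \<le> f0" "0 \<le> f y"
  using f0 by (auto simp: f_def split: split_indicator)

lemma B_nonneg: "0 \<le> B" using \<phi>_le[of 0] by linarith

lemma pert_bound:
  assumes "S \<subseteq> cells"
  shows "\<bar>pert S z\<bar> \<le> amp * B\<^sup>2"
proof -
  have "\<bar>bump_sum \<phi> \<phi> S z\<bar> \<le> B * B"
    by (intro bump_sum_bound \<phi>_0 finite_subset[OF assms finite_cells] \<phi>_le)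
  from mult_left_mono[OF this amp] show ?thesis
    using amp by (simp add: pert_def abs_mult power2_eq_square)
qed

lemma pert_support:
  assumes "S \<subseteq> cells" "pert S z \<noteq> 0"
  shows "z \<in> {a1..b1} \<times> {a2..b2}"
proof -
  have "bump_sum \<phi> \<phi> S z \<noteq> 0" using assms(2) by (simp add: pert_def)
  with bump_sum_cases[where G=\<phi> and H=\<phi> and z=z, OF \<phi>_0 \<phi>_0 finite_subset[OF assms(1) finite_cells]]
  obtain c where "c \<in> S" "z \<in> cell c" by blast
  with cell_subset assms(1) show ?thesis by blast
qed

lemma integrable_\<phi>: "integrable lborel \<phi>"
proof (rule Bochner_Integration.integrable_bound)
  show "integrable lborel (\<lambda>s. indicator {0..1::real} s * B)"
    by (intro integrable_mult_left integrable_real_indicator) auto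
  show "AE s in lborel. norm (\<phi> s) \<le> norm (indicator {0..1} s * B)"
  proof (rule AE_I2)
    fix s show "norm (\<phi> s) \<le> norm (indicator {0..1} s * B)"
      using \<phi>_0[of s] \<phi>_le[of s] by (auto split: split_indicator)
  qed
qed simp

lemma integral_pert:
  "(\<integral>y. pert S (x, y) \<partial>lborel) = 0" "(\<integral>x. pert S (x, y) \<partial>lborel) = 0"
proof -
  have i1: "integrable lborel (\<lambda>x. \<phi> (u x - s))" and i2: "integrable lborel (\<lambda>y. \<phi> (v y - s))" for s
    by (rule integrable_coord[OF ab1 N1 integrable_\<phi>], rule integrable_coord[OF ab2 N2 integrable_\<phi>])
  show "(\<integral>y. pert S (x, y) \<partial>lborel) = 0"
    unfolding pert_def bump_sum_def fst_conv snd_conv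
    by (simp add: Bochner_Integration.integral_sum i2 integral_coord[OF ab2 N2 \<phi>_mean])
  show "(\<integral>x. pert S (x, y) \<partial>lborel) = 0"
    unfolding pert_def bump_sum_def fst_conv snd_conv
    by (simp add: Bochner_Integration.integral_sum i1 integral_coord[OF ab1 N1 \<phi>_mean])
qed

text \<open>
  The perturbation lives where the base density equals \<open>f0\<close> in both variables, so multiplying by
  \<open>f\<close> does not spoil the mean-zero property in the first variable.
\<close>

lemma perturbed_iid_pert:
  assumes S: "S \<subseteq> cells"
  shows "perturbed_iid f (pert S)"
proof
  show "f \<in> borel_measurable borel" unfolding f_def[abs_def] by measurable
  show "0 \<le> f y" for y by (rule f_le)
  have "(\<integral>\<^sup>+y. ennreal (f y) \<partial>lborel)
      = (\<integral>\<^sup>+y. ennreal f0 * indicator {- (1 / (2 * f0))..1 / (2 * f0)} y \<partial>lborel)"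
    by (intro nn_integral_cong) (auto simp: f_def split: split_indicator)
  also have "\<dots> = ennreal (f0 * (1 / (2 * f0) - (- (1 / (2 * f0)))))"
    using f0 by (simp add: nn_integral_cmult ennreal_mult'[symmetric])
  also have "f0 * (1 / (2 * f0) - (- (1 / (2 * f0)))) = 1" using f0 by simp
  finally show "(\<integral>\<^sup>+y. ennreal (f y) \<partial>lborel) = 1" by simp
  show "pert S \<in> borel_measurable borel"
    unfolding pert_def[abs_def] by (intro borel_measurable_times bump_sum_measurable) auto
  show "\<bar>pert S (x, y)\<bar> \<le> f y / 2" for x y
    using pert_bound[OF S, of "(x, y)"] pert_support[OF S, of "(x, y)"] f_eq(2)[of "(x, y)"] amp_small f_le[of y]
    by (cases "pert S (x, y) = 0") auto
  show "(\<integral>y. pert S (x, y) \<partial>lborel) = 0" for x by (rule integral_pert)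
  have "f x * pert S (x, y) = f0 * pert S (x, y)" for x y
    using pert_support[OF S, of "(x, y)"] f_eq(1)[of "(x, y)"] by auto
  then show "(\<integral>x. f x * pert S (x, y) \<partial>lborel) = 0" for y
    by (simp only: integral_mult_right_zero integral_pert mult_zero_right)
qed

abbreviation dens :: "(nat \<times> nat) set \<Rightarrow> real \<times> real \<Rightarrow> real" where
  "dens S \<equiv> perturbed_iid.\<pi> f (pert S)"

lemma dens_eq: "S \<subseteq> cells \<Longrightarrow> dens S z = f (snd z) + pert S z"
  using perturbed_iid.\<pi>_def[OF perturbed_iid_pert] by blast

lemmas dens_transition = perturbed_iid.transition_density_\<pi>[OF perturbed_iid_pert]
lemmas dens_stationary = perturbed_iid.stationary_\<pi>[OF perturbed_iid_pert]
lemmas dens_recurrent = perturbed_iid.positive_recurrent_\<pi>[OF perturbed_iid_pert]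
lemmas dens_bounds = perturbed_iid.\<pi>_bounds[OF perturbed_iid_pert]

lemma dens_invariant:
  assumes "S \<subseteq> cells"
  shows "invariant_distribution (dens S) (stationary_distribution (dens S))"
  using perturbed_iid.invariant_F[OF perturbed_iid_pert[OF assms]] dens_stationary[OF assms] by simp

lemma dens_insert:
  assumes "insert c S \<subseteq> cells" "c \<notin> S"
  shows "dens (insert c S) z = dens S z + amp * (\<phi> (u (fst z) - real (fst c)) * \<phi> (v (snd z) - real (snd c)))"
  using assms finite_subset[OF _ finite_cells, of S]
  by (subst (1 2) dens_eq) (auto simp: pert_def bump_sum_def distrib_left)

context
  fixes S :: "(nat \<times> nat) set" and c :: "nat \<times> nat"
  assumes S: "insert c S \<subseteq> cells" "c \<notin> S"
begin

text \<open>
  Both densities vanish outside the range of the base density, where the quotient has the value \<open>0\<close>.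
\<close>

definition lr :: "real \<times> real \<Rightarrow> real" where
  "lr z = dens (insert c S) z / dens S z"

lemma S_cells: "S \<subseteq> cells" using S by simp

lemma dens_pos: "0 \<le> dens S z" "0 \<le> dens (insert c S) z"
  using perturbed_iid.\<pi>_nonneg[OF perturbed_iid_pert] S S_cells by auto

lemma dens_zero: "dens S z = 0 \<Longrightarrow> dens (insert c S) z = 0"
  using dens_bounds(1)[OF S_cells, of "snd z" "fst z"] dens_bounds(2)[OF S(1), of "fst z" "snd z"]
    dens_pos(2)[of z] f_le(2)[of "snd z"] by simp

lemma lr_pair: "lr_pair (dens S) (dens (insert c S)) lr"
proof
  show "transition_density (dens S)" "transition_density (dens (insert c S))"
    by (intro dens_transition S_cells S)+
  show "invariant_distribution (dens S) (stationary_distribution (dens S))"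
    "invariant_distribution (dens (insert c S)) (stationary_distribution (dens (insert c S)))"
    by (intro dens_invariant S_cells S)+
  show "stationary_distribution (dens (insert c S)) = stationary_distribution (dens S)"
    using dens_stationary S S_cells by simp
  show "lr \<in> borel_measurable (borel \<Otimes>\<^sub>M borel)"
    unfolding lr_def[abs_def]
    by (intro borel_measurable_divide perturbed_iid.\<pi>_meas perturbed_iid_pert S S_cells)
  show "0 \<le> lr z" for z by (simp add: lr_def dens_pos)
  show "dens (insert c S) z = lr z * dens S z" for z
    using dens_zero[of z] by (auto simp: lr_def)
qed

definition in_col :: "real \<Rightarrow> real" where "in_col x = indicator {0<..<1} (u x - real (fst c))"
definition in_row :: "real \<Rightarrow> real" where "in_row y = indicator {0<..<1} (v y - real (snd c))"

text \<open>
  A step from the column of the cell \<open>c\<close> increases the second moment of the likelihood ratio by at most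
  the factor \<open>1 + excess\<close>; averaged over the column, each step costs a factor \<open>1 + growth\<close>.
\<close>

definition excess :: real where "excess = 2 * amp\<^sup>2 * B ^ 4 / f0 * h2"
definition growth :: real where "growth = 9 * amp\<^sup>2 * B ^ 4 * h1 * h2"

lemma in_col_row_range: "0 \<le> in_col x" "in_col x \<le> 1" "0 \<le> in_row x" "in_row x \<le> 1"
  by (auto simp: in_col_def in_row_def)

lemma in_col_row_measurable [measurable]: "in_col \<in> borel_measurable borel" "in_row \<in> borel_measurable borel"
  unfolding in_col_def[abs_def] in_row_def[abs_def] by measurable

lemma excess_growth_nonneg: "0 \<le> excess" "0 \<le> growth"
  using f0 h_pos by (auto simp: excess_def growth_def)

text \<open>
  With \<open>d\<close> the difference of the two densities, \<open>lr\<^sup>2 \<pi> + \<pi> - 2 (\<pi> + d) = d\<^sup>2 / \<pi>\<close>. This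
  chi-square integrand lives on the cell \<open>c\<close>, where \<open>\<pi> \<ge> f0 / 2\<close>. Writing the
  identity without subtraction lets it be integrated with values in \<^typ>\<open>ennreal\<close>.
\<close>

lemma lr_excess:
  "(lr (x, y))\<^sup>2 * dens S (x, y) + dens S (x, y) \<le> 2 * dens (insert c S) (x, y) + 2 * amp\<^sup>2 * B ^ 4 / f0 * in_col x * in_row y"
proof -
  define d where "d = amp * (\<phi> (u x - real (fst c)) * \<phi> (v y - real (snd c)))"
  define p where "p = dens S (x, y)"
  have p': "dens (insert c S) (x, y) = p + d"
    using dens_insert[OF S, of "(x, y)"] by (simp add: d_def p_def)
  show ?thesis
  proof (cases "d = 0")
    case True
    then have "lr (x, y) = 1 \<or> p = 0" using p' by (auto simp: lr_def p_def)
    moreover have "0 \<le> 2 * amp\<^sup>2 * B ^ 4 / f0 * in_col x * in_row y"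
      using f0 by (intro mult_nonneg_nonneg in_col_row_range) auto
    ultimately show ?thesis using p' True by (auto simp: p_def)
  next
    case False
    then have nz: "\<phi> (u x - real (fst c)) \<noteq> 0" "\<phi> (v y - real (snd c)) \<noteq> 0" by (auto simp: d_def)
    then have I: "in_col x = 1" "in_row y = 1"
      using \<phi>_0[of "u x - real (fst c)"] \<phi>_0[of "v y - real (snd c)"] by (auto simp: in_col_def in_row_def split: split_indicator)
    have "(x, y) \<in> cell c"
      using nz \<phi>_0[of "u x - real (fst c)"] \<phi>_0[of "v y - real (snd c)"] by (auto simp: cell_def)
    then have "f y = f0" using cell_subset[of c] S(1) f_eq(2)[of "(x, y)"] by auto
    then have p: "f0 / 2 \<le> p" using dens_bounds(1)[OF S_cells, of y x] by (simp add: p_def)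
    then have p0: "0 < p" using f0 by simp
    have "\<bar>\<phi> (u x - real (fst c)) * \<phi> (v y - real (snd c))\<bar> \<le> B * B"
      unfolding abs_mult by (intro mult_mono \<phi>_le) (auto simp: B_nonneg)
    then have "\<bar>d\<bar> \<le> amp * B\<^sup>2" using amp by (simp add: d_def abs_mult mult_left_mono power2_eq_square)
    then have "\<bar>d\<bar>\<^sup>2 \<le> (amp * B\<^sup>2)\<^sup>2" by (rule power_mono) simp
    then have d2: "d\<^sup>2 \<le> amp\<^sup>2 * B ^ 4" by (simp add: power_mult_distrib flip: power_mult)
    have "(lr (x, y))\<^sup>2 * p + p = 2 * (p + d) + d\<^sup>2 / p"
      using p0 unfolding lr_def p' p_def[symmetric] by (simp add: power2_eq_square field_simps)
    also have "d\<^sup>2 / p \<le> amp\<^sup>2 * B ^ 4 / (f0 / 2)"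
      by (intro frac_le d2 p) (use f0 in auto)
    finally show ?thesis using p' I by (simp add: p_def mult_ac)
  qed
qed

lemma lr_square_le: "(lr (x, y))\<^sup>2 * dens S (x, y) \<le> 9 / 2 * f0"
proof (cases "dens S (x, y) = 0")
  case True
  then show ?thesis using f0 by simp
next
  case False
  define p where "p = dens S (x, y)"
  define p' where "p' = dens (insert c S) (x, y)"
  have p: "0 < p" "f y / 2 \<le> p" and fy: "0 < f y"
    using False dens_pos(1)[of "(x, y)"] dens_bounds[OF S_cells, where x=x and y=y] f_le[of y] by (auto simp: p_def)
  have "0 \<le> p'" "p' \<le> 3 / 2 * f y" using dens_pos(2) dens_bounds(2)[OF S(1)] by (auto simp: p'_def)
  then have "p'\<^sup>2 \<le> (3 / 2 * f y)\<^sup>2" by (intro power_mono)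
  have "(lr (x, y))\<^sup>2 * p = p'\<^sup>2 / p"
    using p(1) unfolding lr_def p_def[symmetric] p'_def[symmetric] by (simp add: power2_eq_square)
  also have "\<dots> \<le> (3 / 2 * f y)\<^sup>2 / (f y / 2)"
    by (intro frac_le \<open>p'\<^sup>2 \<le> _\<close> p) (use fy in auto)
  also have "\<dots> = 9 / 2 * f y" using fy by (simp add: power2_eq_square)
  also have "\<dots> \<le> 9 / 2 * f0" using f_le(1)[of y] by simp
  finally show ?thesis by (simp add: p_def)
qed

lemma nn_integral_in_col: "(\<integral>\<^sup>+x. ennreal (in_col x) \<partial>lborel) = ennreal h1"
  using nn_integral_coord[OF ab1 N1, of "\<lambda>s. ennreal (indicator {0<..<1} s)" "real (fst c)"]
  by (simp add: in_col_def h1_def ennreal_indicator)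

lemma nn_integral_in_row: "(\<integral>\<^sup>+y. ennreal (in_row y) \<partial>lborel) = ennreal h2"
  using nn_integral_coord[OF ab2 N2, of "\<lambda>s. ennreal (indicator {0<..<1} s)" "real (snd c)"]
  by (simp add: in_row_def h2_def ennreal_indicator)

text \<open>
  The weight \<open>1 + excess \<cdot> in_col\<close> at the present state pays for the chi-square distance of the two
  transition laws. The weight of the next state enters through the probability of
  the column, which is of the order \<open>h1\<close> even after the change of measure (\<open>lr_square_le\<close>).
\<close>

lemma lr_step:
  "(\<integral>\<^sup>+y. ennreal (1 + excess * in_col y) * ennreal ((lr (x, y))\<^sup>2 * dens S (x, y)) \<partial>lborel)
    \<le> ennreal (1 + growth) * ennreal (1 + excess * in_col x)"
proof -
  define e where "e = 2 * amp\<^sup>2 * B ^ 4 / f0"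
  have e: "0 \<le> e" using f0 by (simp add: e_def)
  have [measurable]: "lr \<in> borel_measurable (borel \<Otimes>\<^sub>M borel)"
    "dens S \<in> borel_measurable (borel \<Otimes>\<^sub>M borel)" "dens (insert c S) \<in> borel_measurable (borel \<Otimes>\<^sub>M borel)"
    using lr_pair perturbed_iid.\<pi>_meas[OF perturbed_iid_pert] S S_cells by (auto simp: lr_pair_def)
  define q where "q y = (lr (x, y))\<^sup>2 * dens S (x, y)" for y
  have q [measurable]: "q \<in> borel_measurable borel" unfolding q_def[abs_def] by measurable
  have q0: "0 \<le> q y" for y by (simp add: q_def dens_pos)
  define X where "X = (\<integral>\<^sup>+y. ennreal (q y) \<partial>lborel)"
  have one: "(\<integral>\<^sup>+y. ennreal (dens S (x, y)) \<partial>lborel) = 1" "(\<integral>\<^sup>+y. ennreal (dens (insert c S) (x, y)) \<partial>lborel) = 1"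
    using dens_transition[OF S_cells] dens_transition[OF S(1)] by (auto simp: transition_density_def)
  have "X + 1 = (\<integral>\<^sup>+y. ennreal (q y) + ennreal (dens S (x, y)) \<partial>lborel)"
    unfolding X_def one[symmetric] by (rule nn_integral_add[symmetric]) measurable
  also have "\<dots> \<le> (\<integral>\<^sup>+y. 2 * ennreal (dens (insert c S) (x, y)) + ennreal (e * in_col x) * ennreal (in_row y) \<partial>lborel)"
  proof (rule nn_integral_mono)
    fix y
    have "ennreal (q y + dens S (x, y)) \<le> ennreal (2 * dens (insert c S) (x, y) + e * in_col x * in_row y)"
      using lr_excess[of x y] by (intro ennreal_leI) (simp add: q_def e_def)
    also have "\<dots> = 2 * ennreal (dens (insert c S) (x, y)) + ennreal (e * in_col x) * ennreal (in_row y)"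
      using e in_col_row_range dens_pos by (simp add: ennreal_plus ennreal_mult)
    finally show "ennreal (q y) + ennreal (dens S (x, y))
        \<le> 2 * ennreal (dens (insert c S) (x, y)) + ennreal (e * in_col x) * ennreal (in_row y)"
      by (simp add: ennreal_plus q0 dens_pos)
  qed
  also have "\<dots> = 2 + ennreal (e * in_col x) * ennreal h2"
    by (simp add: nn_integral_add nn_integral_cmult one nn_integral_in_row)
  also have "ennreal (e * in_col x) * ennreal h2 = ennreal (excess * in_col x)"
    using e in_col_row_range h_pos by (simp add: excess_def e_def ennreal_mult'[symmetric] mult_ac)
  also have "2 + ennreal (excess * in_col x) = 1 + (1 + ennreal (excess * in_col x))" by (simp flip: add.assoc)
  finally have "1 + X \<le> 1 + (1 + ennreal (excess * in_col x))" by (simp only: add.commute)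
  then have X: "X \<le> ennreal (1 + excess * in_col x)"
    using excess_growth_nonneg in_col_row_range unfolding ennreal_add_left_cancel_le by simp
  have "(\<integral>\<^sup>+y. ennreal (excess * in_col y) * ennreal (q y) \<partial>lborel)
      \<le> (\<integral>\<^sup>+y. ennreal (excess * (9 / 2 * f0)) * ennreal (in_col y) \<partial>lborel)"
  proof (rule nn_integral_mono)
    fix y
    have "(excess * in_col y) * q y \<le> (excess * in_col y) * (9 / 2 * f0)"
      using lr_square_le[of x y] excess_growth_nonneg in_col_row_range by (intro mult_left_mono) (auto simp: q_def)
    then have "ennreal ((excess * in_col y) * q y) \<le> ennreal ((excess * (9 / 2 * f0)) * in_col y)"
      by (intro ennreal_leI) (simp add: mult_ac)
    then show "ennreal (excess * in_col y) * ennreal (q y) \<le> ennreal (excess * (9 / 2 * f0)) * ennreal (in_col y)"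
      using excess_growth_nonneg in_col_row_range f0 q0 by (simp only: ennreal_mult[symmetric] mult_nonneg_nonneg)
  qed
  also have "\<dots> = ennreal (excess * (9 / 2 * f0)) * ennreal h1"
    by (simp add: nn_integral_cmult nn_integral_in_col)
  also have "\<dots> = ennreal growth"
    using excess_growth_nonneg h_pos f0 by (simp add: ennreal_mult'[symmetric] excess_def growth_def mult_ac)
  finally have Y: "(\<integral>\<^sup>+y. ennreal (excess * in_col y) * ennreal (q y) \<partial>lborel) \<le> ennreal growth" .
  have "(\<integral>\<^sup>+y. ennreal (1 + excess * in_col y) * ennreal (q y) \<partial>lborel)
      = (\<integral>\<^sup>+y. ennreal (q y) + ennreal (excess * in_col y) * ennreal (q y) \<partial>lborel)"
    using excess_growth_nonneg in_col_row_range by (intro nn_integral_cong) (simp add: ennreal_plus distrib_right)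
  also have "\<dots> = X + (\<integral>\<^sup>+y. ennreal (excess * in_col y) * ennreal (q y) \<partial>lborel)"
    unfolding X_def by (rule nn_integral_add) measurable
  also have "\<dots> \<le> ennreal (1 + excess * in_col x) + ennreal growth"
    by (intro add_mono X Y)
  also have "\<dots> = ennreal (1 + excess * in_col x + growth)"
    using excess_growth_nonneg in_col_row_range by (simp add: ennreal_plus)
  also have "\<dots> \<le> ennreal ((1 + growth) * (1 + excess * in_col x))"
    using excess_growth_nonneg in_col_row_range by (intro ennreal_leI) (simp add: algebra_simps)
  also have "\<dots> = ennreal (1 + growth) * ennreal (1 + excess * in_col x)"
    using excess_growth_nonneg in_col_row_range by (intro ennreal_mult) auto
  finally show ?thesis by (simp add: q_def)
qed

lemma lr_second_moment:
  "(\<integral>\<^sup>+\<omega>. (path_lr lr n \<omega>)\<^sup>2 \<partial>observation_law (dens S) n) \<le> ennreal ((1 + growth) ^ n * (1 + excess))"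
proof -
  interpret lr_pair "dens S" "dens (insert c S)" lr by (rule lr_pair)
  interpret st: prob_space "stationary_distribution (dens S)"
    using inv by (simp add: invariant_distribution_def)
  have "(\<integral>\<^sup>+\<omega>. (path_lr lr n \<omega>)\<^sup>2 \<partial>observation_law (dens S) n)
      \<le> (\<integral>\<^sup>+\<omega>. (path_lr lr n \<omega>)\<^sup>2 * ennreal (1 + excess * in_col (\<omega> n)) \<partial>observation_law (dens S) n)"
  proof (rule nn_integral_mono)
    fix \<omega>
    have "(1 :: ennreal) \<le> ennreal (1 + excess * in_col (\<omega> n))"
      using excess_growth_nonneg in_col_row_range by simp
    from mult_left_mono[OF this, of "(path_lr lr n \<omega>)\<^sup>2"]
    show "(path_lr lr n \<omega>)\<^sup>2 \<le> (path_lr lr n \<omega>)\<^sup>2 * ennreal (1 + excess * in_col (\<omega> n))" by simp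
  qed
  also have "\<dots> \<le> ennreal (1 + growth) ^ n * (\<integral>\<^sup>+x. ennreal (1 + excess * in_col x) \<partial>stationary_distribution (dens S))"
    by (rule path_lr_second_moment) (measurable, rule lr_step)
  also have "(\<integral>\<^sup>+x. ennreal (1 + excess * in_col x) \<partial>stationary_distribution (dens S))
      \<le> (\<integral>\<^sup>+x. ennreal (1 + excess) \<partial>stationary_distribution (dens S))"
    using excess_growth_nonneg in_col_row_range by (intro nn_integral_mono ennreal_leI) (simp add: mult_left_le)
  also have "\<dots> = ennreal (1 + excess)" by (simp add: st.emeasure_space_1)
  finally have "(\<integral>\<^sup>+\<omega>. (path_lr lr n \<omega>)\<^sup>2 \<partial>observation_law (dens S) n) \<le> ennreal (1 + growth) ^ n * ennreal (1 + excess)"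
    by (simp add: mult_left_mono)
  also have "\<dots> = ennreal ((1 + growth) ^ n * (1 + excess))"
    using excess_growth_nonneg by (simp add: ennreal_mult ennreal_power del: ennreal_plus)
  finally show ?thesis .
qed

text \<open>
  The difference of the two densities on the cell is a product of functions of one variable, each of
  which contributes its cell width and the squared norm \<open>\<sigma>\<close> of the bump.
\<close>

lemma cell_separation:
  "(\<integral>\<^sup>+z\<in>cell c. ennreal ((dens S z - dens (insert c S) z)\<^sup>2 / 2) \<partial>lborel) = ennreal (amp\<^sup>2 / 2 * h1 * h2 * \<sigma>\<^sup>2)"
proof -
  have "(\<integral>\<^sup>+z\<in>cell c. ennreal ((dens S z - dens (insert c S) z)\<^sup>2 / 2) \<partial>lborel)
      = (\<integral>\<^sup>+z. ennreal (amp\<^sup>2 / 2) * ennreal ((\<phi> (u (fst z) - real (fst c)))\<^sup>2) * ennreal ((\<phi> (v (snd z) - real (snd c)))\<^sup>2)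
          \<partial>(lborel \<Otimes>\<^sub>M lborel))"
    unfolding lborel_prod
  proof (rule nn_integral_cong)
    fix z
    have "(dens S z - dens (insert c S) z)\<^sup>2 / 2
        = amp\<^sup>2 / 2 * (\<phi> (u (fst z) - real (fst c)))\<^sup>2 * (\<phi> (v (snd z) - real (snd c)))\<^sup>2"
      unfolding dens_insert[OF S] by (simp add: power_mult_distrib)
    moreover have "z \<notin> cell c \<Longrightarrow> \<phi> (u (fst z) - real (fst c)) = 0 \<or> \<phi> (v (snd z) - real (snd c)) = 0"
      using \<phi>_0 by (auto simp: cell_def)
    moreover have "ennreal (amp\<^sup>2 / 2 * s\<^sup>2 * t\<^sup>2) = ennreal (amp\<^sup>2 / 2) * ennreal (s\<^sup>2) * ennreal (t\<^sup>2)" for s t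
      by (subst ennreal_mult, simp, simp, subst ennreal_mult) simp_all
    ultimately show "ennreal ((dens S z - dens (insert c S) z)\<^sup>2 / 2) * indicator (cell c) z
        = ennreal (amp\<^sup>2 / 2) * ennreal ((\<phi> (u (fst z) - real (fst c)))\<^sup>2) * ennreal ((\<phi> (v (snd z) - real (snd c)))\<^sup>2)"
      by (cases "z \<in> cell c") auto
  qed
  also have "\<dots> = (\<integral>\<^sup>+x. \<integral>\<^sup>+y. ennreal (amp\<^sup>2 / 2) * ennreal ((\<phi> (u x - real (fst c)))\<^sup>2)
      * ennreal ((\<phi> (v y - real (snd c)))\<^sup>2) \<partial>lborel \<partial>lborel)"
    by (subst lborel.nn_integral_fst[symmetric]) auto
  also have "\<dots> = ennreal (amp\<^sup>2 / 2) * (ennreal h1 * ennreal \<sigma>) * (ennreal h2 * ennreal \<sigma>)"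
    using nn_integral_coord[OF ab1 N1, of "\<lambda>s. ennreal ((\<phi> s)\<^sup>2)" "real (fst c)"]
      nn_integral_coord[OF ab2 N2, of "\<lambda>s. ennreal ((\<phi> s)\<^sup>2)" "real (snd c)"]
    by (simp add: nn_integral_cmult nn_integral_multc \<sigma>(2) h1_def h2_def)
  also have "\<dots> = ennreal (amp\<^sup>2 / 2 * h1 * h2 * \<sigma>\<^sup>2)"
  proof -
    have "ennreal (p * (h1 * \<sigma>) * (h2 * \<sigma>)) = ennreal p * (ennreal h1 * ennreal \<sigma>) * (ennreal h2 * ennreal \<sigma>)"
      if "0 \<le> p" for p
      using that h_pos \<sigma>(1) by (simp add: ennreal_mult)
    from this[of "amp\<^sup>2 / 2"] show ?thesis by (simp add: power2_eq_square mult_ac)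
  qed
  finally show ?thesis .
qed

lemma cell_risk:
  assumes T: "T \<in> estimators n" and K: "2 \<le> K" "(1 + growth) ^ n * (1 + excess) \<le> K"
  shows "ennreal (amp\<^sup>2 / 2 * h1 * h2 * \<sigma>\<^sup>2 / K)
    \<le> quadratic_risk (cell c) n T (dens S) + quadratic_risk (cell c) n T (dens (insert c S))"
proof -
  interpret lr_pair "dens S" "dens (insert c S)" lr by (rule lr_pair)
  have "ennreal (amp\<^sup>2 / 2 * h1 * h2 * \<sigma>\<^sup>2 / K) = ennreal (amp\<^sup>2 / 2 * h1 * h2 * \<sigma>\<^sup>2) * ennreal (1 / K)"
    using h_pos K by (simp add: ennreal_mult[symmetric])
  also have "\<dots> \<le> (\<integral>\<^sup>+z\<in>cell c. ennreal ((dens S z - dens (insert c S) z)\<^sup>2 / 2) \<partial>lborel)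
      * (\<integral>\<^sup>+\<omega>. min 1 (path_lr lr n \<omega>) \<partial>observation_law (dens S) n)"
    unfolding cell_separation
    by (intro mult_left_mono path_lr_overlap K order.trans[OF lr_second_moment] ennreal_leI) simp
  also have "\<dots> \<le> quadratic_risk (cell c) n T (dens S) + quadratic_risk (cell c) n T (dens (insert c S))"
    by (rule two_point_risk[OF T]) simp
  finally show ?thesis .
qed

end

text \<open>
  The number of cells cancels the area \<open>h1 h2\<close> of a cell, and a multiple of \<open>amp\<^sup>2\<close> remains.
\<close>

lemma risk_lower_bound:
  assumes T: "T \<in> estimators n" and K: "2 \<le> K"
    "(1 + 9 * amp\<^sup>2 * B ^ 4 * h1 * h2) ^ n * (1 + 2 * amp\<^sup>2 * B ^ 4 / f0 * h2) \<le> K"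
    and sub: "\<And>S. S \<subseteq> cells \<Longrightarrow> dens S \<in> P"
  shows "ennreal ((b1 - a1) * (b2 - a2) * \<sigma>\<^sup>2 * amp\<^sup>2 / (4 * K))
    \<le> (SUP \<pi>\<in>P. quadratic_risk ({a1..b1} \<times> {a2..b2}) n T \<pi>)"
proof -
  define A where "A = {a1..b1} \<times> {a2..b2}"
  define s where "s = (SUP \<pi>\<in>P. quadratic_risk A n T \<pi>)"
  have "of_nat (card cells) * ennreal (amp\<^sup>2 / 2 * h1 * h2 * \<sigma>\<^sup>2 / K) \<le> 2 * s"
  proof (rule hypercube_average[OF finite_cells, where r="\<lambda>S c. quadratic_risk (cell c) n T (dens S)"])
    fix S c assume "S \<subseteq> cells" "c \<in> cells - S"
    then show "ennreal (amp\<^sup>2 / 2 * h1 * h2 * \<sigma>\<^sup>2 / K)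
      \<le> quadratic_risk (cell c) n T (dens S) + quadratic_risk (cell c) n T (dens (insert c S))"
      using K by (intro cell_risk T) (auto simp: growth_def excess_def)
  next
    fix S assume S: "S \<subseteq> cells"
    have "(\<Sum>c\<in>cells. quadratic_risk (cell c) n T (dens S)) \<le> quadratic_risk A n T (dens S)"
      by (rule sum_quadratic_risk_le)
        (use S T cell_subset in \<open>auto simp: A_def dens_transition dens_invariant finite_cells disjoint_cells\<close>)
    also have "\<dots> \<le> s" unfolding s_def by (intro SUP_upper sub S)
    finally show "(\<Sum>c\<in>cells. quadratic_risk (cell c) n T (dens S)) \<le> s" .
  qed
  also have "of_nat (card cells) * ennreal (amp\<^sup>2 / 2 * h1 * h2 * \<sigma>\<^sup>2 / K)
      = ennreal (2 * ((b1 - a1) * (b2 - a2) * \<sigma>\<^sup>2 * amp\<^sup>2 / (4 * K)))"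
  proof -
    have "real (card cells) * (amp\<^sup>2 / 2 * h1 * h2 * \<sigma>\<^sup>2 / K)
        = 2 * ((b1 - a1) * (b2 - a2) * \<sigma>\<^sup>2 * amp\<^sup>2 / (4 * K))"
    proof -
      have "real (card cells) * (h1 * h2) = (b1 - a1) * (b2 - a2)"
        using N1 N2 by (simp add: cells_def h1_def h2_def)
      moreover have "real (card cells) * (amp\<^sup>2 / 2 * h1 * h2 * \<sigma>\<^sup>2 / K)
          = real (card cells) * (h1 * h2) * (amp\<^sup>2 / 2 * \<sigma>\<^sup>2 / K)"
        by simp
      ultimately show ?thesis by simp
    qed
    moreover have "of_nat (card cells) * ennreal x = ennreal (real (card cells) * x)" for x
      by (simp add: ennreal_of_nat_eq_real_of_nat ennreal_mult')
    ultimately show ?thesis by (simp only:)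
  qed
  also have "\<dots> = 2 * ennreal ((b1 - a1) * (b2 - a2) * \<sigma>\<^sup>2 * amp\<^sup>2 / (4 * K))"
    using ab1 ab2 K(1) by (subst ennreal_mult) auto
  finally have "ennreal ((b1 - a1) * (b2 - a2) * \<sigma>\<^sup>2 * amp\<^sup>2 / (4 * K)) \<le> s"
    by (simp add: ennreal_mult_le_mult_iff)
  then show ?thesis by (simp add: s_def A_def)
qed

end

section \<open>The rate\<close>

text \<open>
  On the rectangle the densities differ from a constant by a sum of bumps, and differences of positive
  order annihilate constants.
\<close>

lemma (in hypercube_model) dens_in_class:
  fixes D :: "nat \<Rightarrow> real \<Rightarrow> real"
  assumes S: "S \<subseteq> cells" and \<alpha>: "0 < \<alpha>1" "0 < \<alpha>2" "\<alpha>1 < real r1" "\<alpha>2 < real r2"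
    and D_0: "D 0 = \<phi>"
    and D: "\<And>i s. i < max r1 r2 \<Longrightarrow> (D i has_real_derivative D (Suc i) s) (at s)"
    and D0: "\<And>i s. i \<le> max r1 r2 \<Longrightarrow> s \<notin> {0<..<1} \<Longrightarrow> D i s = 0"
    and DB: "\<And>i s. i \<le> max r1 r2 \<Longrightarrow> \<bar>D i s\<bar> \<le> B"
    and L: "sqrt ((b1 - a1) * (b2 - a2)) *
      (3 / 2 * f0 + 2 ^ r1 * (amp * B\<^sup>2) * (1 / h1) powr \<alpha>1 + 2 ^ r2 * (amp * B\<^sup>2) * (1 / h2) powr \<alpha>2) \<le> L"
  shows "dens S \<in> besov_transition_class \<alpha>1 \<alpha>2 r1 r2 ({a1..b1} \<times> {a2..b2}) L"
proof -
  define A where "A = {a1..b1} \<times> {a2..b2}"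
  have fin: "finite S" by (rule finite_subset[OF S finite_cells])
  have on_A: "dens S z = f0 + pert S z" if "z \<in> A" for z
    using that f_eq(2)[of z] by (simp add: dens_eq[OF S] A_def)
  have shift: "iterated_diff e r h (dens S) z = iterated_diff e r h (\<lambda>z. f0 + pert S z) z"
    if "z \<in> diff_domain A e r h" for e r h z
    unfolding iterated_diff_def using that on_A by (intro sum.cong) (auto simp: diff_domain_def)
  have scale: "(\<bar>h\<bar> / s) powr a = (1 / s) powr a * \<bar>h\<bar> powr a" if "0 < s" for h s a :: real
    using that powr_mult[of "1 / s" "\<bar>h\<bar>" a] by simp
  have diff1: "\<bar>iterated_diff (1, 0) r1 h (dens S) z\<bar> \<le> 2 ^ r1 * (amp * B\<^sup>2) * (1 / h1) powr \<alpha>1 * \<bar>h\<bar> powr \<alpha>1"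
    if z: "z \<in> diff_domain A (1, 0) r1 h" for h z
  proof -
    obtain x y where xy: "z = (x, y)" by (cases z)
    have "iterated_diff (1, 0) r1 h (dens S) z = fdiff r1 h (\<lambda>x. amp * bump_sum (D 0) (D 0) S (x, y)) x"
      using \<alpha> unfolding shift[OF z] unfolding xy iterated_diff_coordinate pert_def D_0
      by (intro fdiff_add_const) simp
    also have "\<bar>\<dots>\<bar> \<le> 2 ^ r1 * (amp * B\<^sup>2) * (\<bar>h\<bar> / h1) powr \<alpha>1"
      unfolding h1_def by (rule fdiff_bump_sum(1)[OF fin \<alpha>(1,3) amp]) (simp_all add: D D0 DB)
    finally show ?thesis by (simp only: scale[OF h_pos(1)] mult.assoc)
  qed
  have diff2: "\<bar>iterated_diff (0, 1) r2 h (dens S) z\<bar> \<le> 2 ^ r2 * (amp * B\<^sup>2) * (1 / h2) powr \<alpha>2 * \<bar>h\<bar> powr \<alpha>2"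
    if z: "z \<in> diff_domain A (0, 1) r2 h" for h z
  proof -
    obtain x y where xy: "z = (x, y)" by (cases z)
    have "iterated_diff (0, 1) r2 h (dens S) z = fdiff r2 h (\<lambda>y. amp * bump_sum (D 0) (D 0) S (x, y)) y"
      using \<alpha> unfolding shift[OF z] unfolding xy iterated_diff_coordinate pert_def D_0
      by (intro fdiff_add_const) simp
    also have "\<bar>\<dots>\<bar> \<le> 2 ^ r2 * (amp * B\<^sup>2) * (\<bar>h\<bar> / h2) powr \<alpha>2"
      unfolding h2_def by (rule fdiff_bump_sum(2)[OF fin \<alpha>(2,4) amp]) (simp_all add: D D0 DB)
    finally show ?thesis by (simp only: scale[OF h_pos(2)] mult.assoc)
  qed
  have bound: "\<bar>dens S z\<bar> \<le> 3 / 2 * f0" for z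
    using dens_bounds[OF S, where x="fst z" and y="snd z"] f_le[of "snd z"] by simp
  have meas: "dens S \<in> borel_measurable borel"
    using dens_transition[OF S] by (simp add: transition_density_def)
  have K: "0 \<le> 3 / 2 * f0" "0 \<le> 2 ^ r1 * (amp * B\<^sup>2) * (1 / h1) powr \<alpha>1"
    "0 \<le> 2 ^ r2 * (amp * B\<^sup>2) * (1 / h2) powr \<alpha>2"
    using f0 amp by auto
  note besov = besov_norm_le[OF A_def less_imp_le[OF ab1] less_imp_le[OF ab2] \<alpha>(1,2) K meas bound diff1 diff2]
  have "besov_norm \<alpha>1 \<alpha>2 r1 r2 A (dens S) \<le> L"
    by (rule order.trans[OF besov(2) L])
  with besov(1) show ?thesis
    unfolding besov_transition_class_def A_def[symmetric]
    using dens_transition[OF S] dens_recurrent[OF S] by blast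
qed

lemma rate_exponent:
  assumes "0 < \<alpha>1" "0 < \<alpha>2"
  shows "2 * harmonic_mean \<alpha>1 \<alpha>2 / (2 * harmonic_mean \<alpha>1 \<alpha>2 + 2) = 2 / (2 + (1 / \<alpha>1 + 1 / \<alpha>2))"
proof -
  define s where "s = 1 / \<alpha>1 + 1 / \<alpha>2"
  have "0 < s" using assms by (simp add: s_def add_pos_pos)
  then show ?thesis
    unfolding harmonic_mean_def s_def[symmetric] by (simp add: field_simps)
qed

text \<open>
  The finest grid whose bumps of height \<open>\<tau>\<close> still have bounded Hoelder norm of order \<open>\<alpha>\<close> has cell
  width of the order \<open>\<tau>\<^bsup>1/\<alpha>\<^esup>\<close>. Rounding the number of cells down to an integer at most doubles
  the width, since that number is at least one.
\<close>

lemma resolution: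
  fixes \<tau> \<alpha> len :: real
  assumes \<tau>: "0 < \<tau>" "\<tau> \<le> 1" and \<alpha>: "0 < \<alpha>" and len: "0 < len"
  defines "N \<equiv> nat \<lfloor>\<tau> powr (- (1 / \<alpha>))\<rfloor>"
  shows "0 < N" and "(1 / (len / real N)) powr \<alpha> \<le> len powr (- \<alpha>) / \<tau>"
    and "len / real N \<le> 2 * len * \<tau> powr (1 / \<alpha>)" and "len / real N \<le> len"
proof -
  define X where "X = \<tau> powr (- (1 / \<alpha>))"
  have X: "1 \<le> X" unfolding X_def using \<tau> \<alpha> by (simp add: powr_minus_divide powr_le1)
  have "1 \<le> \<lfloor>X\<rfloor>" using X by simp
  then have "real N = of_int \<lfloor>X\<rfloor>" "1 \<le> real N" by (simp_all add: N_def X_def)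
  then have N: "real N \<le> X" "X \<le> 2 * real N" "1 \<le> real N" by linarith+
  then show "0 < N" by simp
  have "(1 / (len / real N)) powr \<alpha> \<le> (X * (1 / len)) powr \<alpha>"
    using N len \<alpha> by (intro powr_mono2) (auto simp: divide_right_mono)
  also have "\<dots> = X powr \<alpha> * (1 / len) powr \<alpha>" by (rule powr_mult)
  also have "X powr \<alpha> = 1 / \<tau>" unfolding X_def powr_powr using \<tau> \<alpha> by (simp add: powr_minus_divide)
  also have "(1 / len) powr \<alpha> = len powr (- \<alpha>)" using len by (simp add: powr_divide powr_minus_divide)
  finally show "(1 / (len / real N)) powr \<alpha> \<le> len powr (- \<alpha>) / \<tau>" by simp
  have "1 / real N \<le> 2 / X" using N X by (simp add: field_simps)
  also have "\<dots> = 2 * \<tau> powr (1 / \<alpha>)" by (simp add: X_def powr_minus_divide)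
  finally have "len * (1 / real N) \<le> len * (2 * \<tau> powr (1 / \<alpha>))" using len by (intro mult_left_mono) auto
  then show "len / real N \<le> 2 * len * \<tau> powr (1 / \<alpha>)" by simp
  have "len * 1 \<le> len * real N" using len N by (intro mult_left_mono) auto
  then show "len / real N \<le> len" using N by (simp add: divide_le_eq)
qed

theorem theorem6:
  fixes a1 b1 a2 b2 L \<alpha>1 \<alpha>2 :: real and r1 r2 :: nat and A :: "(real \<times> real) set"
  assumes "a1 < b1" and "a2 < b2" and "A = {a1..b1} \<times> {a2..b2}"
    and "0 < L" and "0 < \<alpha>1" and "0 < \<alpha>2"
    and "\<alpha>1 < real r1" and "\<alpha>2 < real r2"
  shows "\<exists>C>0. \<forall>\<^sub>F n in sequentially.
    (INF T\<in>estimators n. SUP \<pi>\<in>besov_transition_class \<alpha>1 \<alpha>2 r1 r2 A L. quadratic_risk A n T \<pi>)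
      \<ge> ennreal (C * real n powr
            (- (2 * harmonic_mean \<alpha>1 \<alpha>2 / (2 * harmonic_mean \<alpha>1 \<alpha>2 + 2))))"
proof -
  obtain D :: "nat \<Rightarrow> real \<Rightarrow> real" and B \<sigma> where B: "1 \<le> B"
    and D: "\<forall>i<max r1 r2. \<forall>s. (D i has_real_derivative D (Suc i) s) (at s)"
      "\<forall>i\<le>max r1 r2. \<forall>s. s \<notin> {0<..<1} \<longrightarrow> D i s = 0" "\<forall>i\<le>max r1 r2. \<forall>s. \<bar>D i s\<bar> \<le> B"
      "D 0 \<in> borel_measurable borel" "(\<integral>s. D 0 s \<partial>lborel) = 0"
    and \<sigma>: "0 < \<sigma>" "(\<integral>\<^sup>+s. ennreal ((D 0 s)\<^sup>2) \<partial>lborel) = ennreal \<sigma>"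
    using ex_smooth_mean_zero_bump[of "max r1 r2"] by blast
  define l1 where "l1 = b1 - a1"
  define l2 where "l2 = b2 - a2"
  define w where "w = sqrt (l1 * l2)"
  have l: "0 < l1" "0 < l2" "0 < w" using assms(1,2) by (auto simp: l1_def l2_def w_def)
  define R where "R = 1 + \<bar>a1\<bar> + \<bar>b1\<bar> + \<bar>a2\<bar> + \<bar>b2\<bar>"
  \<comment> \<open>The first bound leaves room for the perturbation in the Besov ball: the densities are at most
    \<open>3 / 2 \<cdot> f0\<close>, which contributes at most \<open>3 L / 4\<close> to the norm. The second bound makes the range
    of the base density contain \<open>[-R, R]\<close>.\<close>
  define f0 where "f0 = min (L / (2 * w)) (1 / (2 * R))"
  have R: "0 < R" by (simp add: R_def)
  have level: "0 < f0" "f0 \<le> L / (2 * w)" "f0 \<le> 1 / (2 * R)"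
    using assms(4) l R by (auto simp: f0_def)
  have "R \<le> 1 / (2 * f0)" using level R by (simp add: field_simps)
  then have range: "{a1..b1} \<union> {a2..b2} \<subseteq> {- (1 / (2 * f0))..1 / (2 * f0)}"
    by (auto simp: R_def)
  define M where "M = 2 ^ r1 * l1 powr (- \<alpha>1) + 2 ^ r2 * l2 powr (- \<alpha>2)"
  have M: "0 < M" using l by (simp add: M_def add_pos_pos)
  \<comment> \<open>The first bound gives \<open>amp_small\<close>, the second one bounds the differences of the perturbation, which
    contribute the remaining \<open>L / 4\<close> to the norm.\<close>
  define \<kappa> where "\<kappa> = min (f0 / (2 * B\<^sup>2)) (L / (4 * w * B\<^sup>2 * M))"
  have \<kappa>: "0 < \<kappa>" "\<kappa> * B\<^sup>2 \<le> f0 / 2" "w * (\<kappa> * B\<^sup>2 * M) \<le> L / 4"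
  proof -
    show "0 < \<kappa>" using level B l M assms(4) by (simp add: \<kappa>_def)
    have "\<kappa> * B\<^sup>2 \<le> f0 / (2 * B\<^sup>2) * B\<^sup>2" by (intro mult_right_mono) (auto simp: \<kappa>_def)
    then show "\<kappa> * B\<^sup>2 \<le> f0 / 2" using B by simp
    have "\<kappa> * (w * B\<^sup>2 * M) \<le> L / (4 * w * B\<^sup>2 * M) * (w * B\<^sup>2 * M)"
      using l M by (intro mult_right_mono) (auto simp: \<kappa>_def)
    also have "\<dots> = L / 4" using l M B by simp
    finally show "w * (\<kappa> * B\<^sup>2 * M) \<le> L / 4" by (simp add: mult_ac)
  qed
  define K where "K = 2 + exp (36 * \<kappa>\<^sup>2 * B ^ 4 * (l1 * l2)) * (1 + 2 * \<kappa>\<^sup>2 * B ^ 4 / f0 * l2)"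
  have K: "2 \<le> K" using level l by (auto simp: K_def intro!: mult_nonneg_nonneg add_nonneg_nonneg)
  define C where "C = l1 * l2 * \<sigma>\<^sup>2 * \<kappa>\<^sup>2 / (4 * K)"
  have C: "0 < C" using l \<sigma> \<kappa> K by (simp add: C_def)
  define s where "s = 1 / \<alpha>1 + 1 / \<alpha>2"
  have s: "0 < s" using assms by (simp add: s_def add_pos_pos)
  have main: "ennreal (C * real n powr (- (2 / (2 + s))))
      \<le> (SUP \<pi>\<in>besov_transition_class \<alpha>1 \<alpha>2 r1 r2 A L. quadratic_risk A n T \<pi>)"
    if n: "1 \<le> n" and T: "T \<in> estimators n" for n T
  proof -
    \<comment> \<open>The solution of \<open>n \<tau>\<^sup>2 \<tau>\<^bsup>1/\<alpha>1\<^esup> \<tau>\<^bsup>1/\<alpha>2\<^esup> = 1\<close>, where the last two factors are the orders of the cell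
      widths.\<close>
    define \<tau> where "\<tau> = real n powr (- (1 / (2 + s)))"
    have \<tau>: "0 < \<tau>" "\<tau> \<le> 1"
      using n s by (auto simp: \<tau>_def powr_minus_divide intro!: ge_one_powr_ge_zero)
    have \<tau>2: "\<tau>\<^sup>2 = real n powr (- (2 / (2 + s)))"
      using n by (simp add: \<tau>_def powr_powr flip: powr_numeral)
    have \<tau>n: "real n * (\<tau>\<^sup>2 * \<tau> powr s) = 1"
    proof -
      have "\<tau>\<^sup>2 * \<tau> powr s = \<tau> powr (2 + s)" using \<tau> by (simp add: powr_add)
      also have "\<dots> = real n powr (- 1)" using s by (simp add: \<tau>_def powr_powr)
      finally show ?thesis using n by (simp add: powr_minus_divide)
    qed
    define N1 where "N1 = nat \<lfloor>\<tau> powr (- (1 / \<alpha>1))\<rfloor>"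
    define N2 where "N2 = nat \<lfloor>\<tau> powr (- (1 / \<alpha>2))\<rfloor>"
    note res1 = resolution[OF \<tau> assms(5) l(1), folded N1_def]
    note res2 = resolution[OF \<tau> assms(6) l(2), folded N2_def]
    define amp where "amp = \<kappa> * \<tau>"
    have amp_bounds: "0 \<le> amp" "amp * B\<^sup>2 \<le> f0 / 2" "amp\<^sup>2 \<le> \<kappa>\<^sup>2"
    proof -
      show "0 \<le> amp" using \<kappa> \<tau> by (simp add: amp_def)
      have le: "amp \<le> \<kappa>" using mult_left_mono[OF \<tau>(2), of \<kappa>] \<kappa> by (simp add: amp_def)
      then have "amp * B\<^sup>2 \<le> \<kappa> * B\<^sup>2" by (intro mult_right_mono) auto
      with \<kappa>(2) show "amp * B\<^sup>2 \<le> f0 / 2" by simp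
      show "amp\<^sup>2 \<le> \<kappa>\<^sup>2" using le \<open>0 \<le> amp\<close> by (rule power_mono)
    qed
    interpret hypercube_model a1 b1 a2 b2 N1 N2 f0 amp B \<sigma> "D 0"
      by unfold_locales (use assms(1,2) res1(1) res2(1) level(1) amp_bounds range D \<sigma> in auto)
    have h: "h1 = l1 / real N1" "h2 = l2 / real N2" by (auto simp: h1_def h2_def l1_def l2_def)
    have in_class: "dens S \<in> besov_transition_class \<alpha>1 \<alpha>2 r1 r2 A L" if S: "S \<subseteq> cells" for S
      unfolding assms(3)
    proof (rule dens_in_class[where D=D, OF S assms(5-8) refl])
      have "2 ^ r1 * (amp * B\<^sup>2) * (1 / h1) powr \<alpha>1 \<le> 2 ^ r1 * (amp * B\<^sup>2) * (l1 powr (- \<alpha>1) / \<tau>)"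
        unfolding h using amp_bounds by (intro mult_left_mono res1) auto
      also have "\<dots> = \<kappa> * B\<^sup>2 * (2 ^ r1 * l1 powr (- \<alpha>1))" using \<tau> by (simp add: amp_def)
      finally have 1: "2 ^ r1 * (amp * B\<^sup>2) * (1 / h1) powr \<alpha>1 \<le> \<kappa> * B\<^sup>2 * (2 ^ r1 * l1 powr (- \<alpha>1))" .
      have "2 ^ r2 * (amp * B\<^sup>2) * (1 / h2) powr \<alpha>2 \<le> 2 ^ r2 * (amp * B\<^sup>2) * (l2 powr (- \<alpha>2) / \<tau>)"
        unfolding h using amp_bounds by (intro mult_left_mono res2) auto
      also have "\<dots> = \<kappa> * B\<^sup>2 * (2 ^ r2 * l2 powr (- \<alpha>2))" using \<tau> by (simp add: amp_def)
      finally have 2: "2 ^ r2 * (amp * B\<^sup>2) * (1 / h2) powr \<alpha>2 \<le> \<kappa> * B\<^sup>2 * (2 ^ r2 * l2 powr (- \<alpha>2))" .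
      have "w * (3 / 2 * f0 + 2 ^ r1 * (amp * B\<^sup>2) * (1 / h1) powr \<alpha>1 + 2 ^ r2 * (amp * B\<^sup>2) * (1 / h2) powr \<alpha>2)
          \<le> w * (3 / 2 * f0 + \<kappa> * B\<^sup>2 * M)"
        unfolding M_def distrib_left[of "\<kappa> * B\<^sup>2"] add.assoc
        using l by (intro mult_left_mono add_mono order_refl 1 2) auto
      also have "\<dots> \<le> L"
      proof -
        have "w * f0 \<le> L / 2" using level(2) l by (simp add: field_simps)
        with \<kappa>(3) show ?thesis by (simp add: distrib_left)
      qed
      finally show "sqrt ((b1 - a1) * (b2 - a2)) * (3 / 2 * f0 + 2 ^ r1 * (amp * B\<^sup>2) * (1 / h1) powr \<alpha>1
          + 2 ^ r2 * (amp * B\<^sup>2) * (1 / h2) powr \<alpha>2) \<le> L"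
        by (simp add: w_def l1_def l2_def)
    qed (use D in auto)
    have info: "(1 + 9 * amp\<^sup>2 * B ^ 4 * h1 * h2) ^ n * (1 + 2 * amp\<^sup>2 * B ^ 4 / f0 * h2) \<le> K"
    proof -
      define \<delta> where "\<delta> = 9 * amp\<^sup>2 * B ^ 4 * h1 * h2"
      have \<delta>: "0 \<le> \<delta>" using h_pos by (simp add: \<delta>_def)
      have "h1 * h2 \<le> (2 * l1 * \<tau> powr (1 / \<alpha>1)) * (2 * l2 * \<tau> powr (1 / \<alpha>2))"
        unfolding h using l by (intro mult_mono res1(3) res2(3)) auto
      also have "\<dots> = 4 * (l1 * l2) * \<tau> powr s" by (simp add: s_def powr_add)
      finally have "9 * amp\<^sup>2 * B ^ 4 * (h1 * h2) \<le> 9 * amp\<^sup>2 * B ^ 4 * (4 * (l1 * l2) * \<tau> powr s)"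
        by (intro mult_left_mono) auto
      then have "real n * \<delta> \<le> real n * (9 * amp\<^sup>2 * B ^ 4 * (4 * (l1 * l2) * \<tau> powr s))"
        unfolding \<delta>_def by (intro mult_left_mono) (auto simp: mult.assoc)
      also have "\<dots> = 36 * \<kappa>\<^sup>2 * B ^ 4 * (l1 * l2) * (real n * (\<tau>\<^sup>2 * \<tau> powr s))"
        by (simp add: amp_def power_mult_distrib)
      also have "\<dots> = 36 * \<kappa>\<^sup>2 * B ^ 4 * (l1 * l2)" by (simp add: \<tau>n)
      finally have n\<delta>: "real n * \<delta> \<le> 36 * \<kappa>\<^sup>2 * B ^ 4 * (l1 * l2)" .
      have "(1 + \<delta>) ^ n \<le> exp \<delta> ^ n" using \<delta> by (intro power_mono exp_ge_add_one_self) auto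
      also have "\<dots> = exp (real n * \<delta>)" by (rule exp_of_nat_mult[symmetric])
      also have "\<dots> \<le> exp (36 * \<kappa>\<^sup>2 * B ^ 4 * (l1 * l2))" using n\<delta> by simp
      finally have 1: "(1 + \<delta>) ^ n \<le> exp (36 * \<kappa>\<^sup>2 * B ^ 4 * (l1 * l2))" .
      have "2 * amp\<^sup>2 * B ^ 4 / f0 * h2 \<le> 2 * \<kappa>\<^sup>2 * B ^ 4 / f0 * l2"
        unfolding h using amp_bounds level l res2(4)
        by (intro mult_mono divide_right_mono mult_right_mono) auto
      then have "(1 + \<delta>) ^ n * (1 + 2 * amp\<^sup>2 * B ^ 4 / f0 * h2)
          \<le> exp (36 * \<kappa>\<^sup>2 * B ^ 4 * (l1 * l2)) * (1 + 2 * \<kappa>\<^sup>2 * B ^ 4 / f0 * l2)"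
        using 1 level h_pos by (intro mult_mono) auto
      then show ?thesis by (simp add: K_def \<delta>_def)
    qed
    have "C * real n powr (- (2 / (2 + s))) = (b1 - a1) * (b2 - a2) * \<sigma>\<^sup>2 * amp\<^sup>2 / (4 * K)"
      by (simp add: \<tau>2[symmetric] C_def amp_def l1_def l2_def power_mult_distrib)
    with risk_lower_bound[OF T K info in_class] show ?thesis by (simp add: assms(3))
  qed
  show ?thesis
  proof (intro exI[of _ C] conjI C eventually_sequentiallyI[of 1])
    fix n :: nat assume "1 \<le> n"
    then show "ennreal (C * real n powr (- (2 * harmonic_mean \<alpha>1 \<alpha>2 / (2 * harmonic_mean \<alpha>1 \<alpha>2 + 2))))
        \<le> (INF T\<in>estimators n. SUP \<pi>\<in>besov_transition_class \<alpha>1 \<alpha>2 r1 r2 A L. quadratic_risk A n T \<pi>)"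
      unfolding rate_exponent[OF assms(5,6)] s_def[symmetric] by (intro INF_greatest main)
  qed
qed

end
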